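(* The size-Ramsey number of the $n\times n$ square grid satisfies $\hat r(G_{n,n})\leq n^{3+o(1)}$ as $n\to\infty$; that is, for every $\varepsilon>0$ there is $n_0$ such that $\hat r(G_{n,n})\leq n^{3+\varepsilon}$ for all $n\geq n_0$.
   Context: For graphs $F$ and $G$, write $G\longrightarrow F$ if every $2$-colouring of the edges of $G$ yields a monochromatic copy of $F$ (as a not necessarily induced subgraph). The size-Ramsey number of $F$ is $\hat r(F)=\min\{e(G)\colon G\longrightarrow F\}$, where $e(G)$ is the number of edges of $G$. The grid graph $G_{s,t}$ has vertex set $[s]\times[t]$, where $[k]=\{1,\dots,k\}$, and $uv$ is an edge if and only if $u$ and $v$ differ in exactly one coordinate, by exactly one. *)

theory Defs
  imports Complex_Main "HOL-Library.Ramsey"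
begin

type_synonym 'a graph = "'a set \<times> 'a set set"

abbreviation verts :: "'a graph \<Rightarrow> 'a set" where "verts \<equiv> fst"
abbreviation edges :: "'a graph \<Rightarrow> 'a set set" where "edges \<equiv> snd"

definition finite_graph :: "'a graph \<Rightarrow> bool" where
  "finite_graph G \<longleftrightarrow> finite (verts G) \<and> edges G \<subseteq> [verts G]\<^bsup>2\<^esup>"

text \<open>A copy of \<open>F\<close> in \<open>G\<close>, not necessarily induced, is given by an injection \<open>f\<close> of
  the vertices that maps every edge of \<open>F\<close> to an edge of \<open>G\<close>.\<close>

definition is_copy :: "('a \<Rightarrow> 'b) \<Rightarrow> 'a graph \<Rightarrow> 'b graph \<Rightarrow> bool" where
  "is_copy f F G \<longleftrightarrow> inj_on f (verts F) \<and> f ` verts F \<subseteq> verts G \<and> (\<forall>e\<in>edges F. f ` e \<in> edges G)"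

text \<open>A colouring is total on sets of vertices; only its values on the edges of \<open>G\<close>
  matter.\<close>

definition arrows :: "'b graph \<Rightarrow> 'a graph \<Rightarrow> bool" where
  "arrows G F \<longleftrightarrow> (\<forall>c :: 'b set \<Rightarrow> bool.
     \<exists>f k. is_copy f F G \<and> (\<forall>e\<in>edges F. c (f ` e) = k))"

text \<open>Every finite graph is isomorphic to one whose vertices are natural numbers, so it is
  enough to let the host graph range over the latter. For finite \<open>F\<close> the minimum is over a
  nonempty set, see \<open>size_ramsey_attained\<close> below.\<close>

definition size_ramsey :: "'a graph \<Rightarrow> nat" where
  "size_ramsey F = (LEAST m. \<exists>G :: nat graph. finite_graph G \<and> arrows G F \<and> card (edges G) = m)"

definition grid_graph :: "nat \<Rightarrow> nat \<Rightarrow> (nat \<times> nat) graph" where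
  "grid_graph s t =
     ({1..s} \<times> {1..t},
      {{u, v} | u v. u \<in> {1..s} \<times> {1..t} \<and> v \<in> {1..s} \<times> {1..t} \<and>
         (fst u = fst v \<and> \<bar>int (snd u) - int (snd v)\<bar> = 1 \<or>
          snd u = snd v \<and> \<bar>int (fst u) - int (fst v)\<bar> = 1)})"

lemma finite_graph_grid: "finite_graph (grid_graph s t)"
  by (auto simp: finite_graph_def grid_graph_def)

lemma ex_arrows:
  assumes "finite_graph F"
  shows "\<exists>G :: nat graph. finite_graph G \<and> arrows G F"
proof -
  define n where "n = card (verts F)"
  obtain N :: nat where "N \<ge> 1" and N:
    "\<And>(V :: nat set) E. finite V \<Longrightarrow> card V \<ge> N \<Longrightarrow>
       \<exists>R \<subseteq> V. card R = n \<and> clique R E \<or> card R = n \<and> indep R E"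
    using ramsey2[of n n] by blast
  define G :: "nat graph" where "G = ({..<N}, [{..<N}]\<^bsup>2\<^esup>)"
  have "\<exists>f k. is_copy f F G \<and> (\<forall>e\<in>edges F. c (f ` e) = k)" for c :: "nat set \<Rightarrow> bool"
  proof -
    obtain R where R: "R \<subseteq> {..<N}" "card R = n" "clique R {e. c e} \<or> indep R {e. c e}"
      using N[of "{..<N}" "{e. c e}"] by auto
    have "finite R"
      using R(1) finite_subset by blast
    then obtain f where f: "bij_betw f (verts F) R"
      using assms R(2) unfolding n_def finite_graph_def by (metis finite_same_card_bij)
    have e: "\<exists>x y. e = {x, y} \<and> f x \<in> R \<and> f y \<in> R \<and> f x \<noteq> f y" if "e \<in> edges F" for e
    proof -
      from that assms have "e \<in> [verts F]\<^bsup>2\<^esup>"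
        by (auto simp: finite_graph_def)
      then obtain x y where "e = {x, y}" "x \<in> verts F" "y \<in> verts F" "x \<noteq> y"
        by (rule nsets2_E)
      with f show ?thesis
        by (auto simp: bij_betw_def inj_on_def)
    qed
    have "is_copy f F G"
      unfolding is_copy_def
    proof (intro conjI ballI)
      show "inj_on f (verts F)" "f ` verts F \<subseteq> verts G"
        using f R(1) by (auto simp: bij_betw_def G_def)
      show "f ` a \<in> edges G" if "a \<in> edges F" for a
        using e[OF that] R(1) by (auto simp: G_def)
    qed
    moreover have "\<exists>k. \<forall>a\<in>edges F. c (f ` a) = k"
      using R(3)
    proof
      assume "clique R {e. c e}"
      then have "\<forall>a\<in>edges F. c (f ` a) = True"
        using e by (fastforce simp: clique_def)
      then show ?thesis by blast
    next
      assume "indep R {e. c e}"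
      then have "\<forall>a\<in>edges F. c (f ` a) = False"
        using e by (fastforce simp: indep_def)
      then show ?thesis by blast
    qed
    ultimately show ?thesis by blast
  qed
  then have "arrows G F" by (simp add: arrows_def)
  moreover have "finite_graph G" by (simp add: finite_graph_def G_def)
  ultimately show ?thesis by blast
qed

lemma size_ramsey_attained:
  assumes "finite_graph F"
  shows "\<exists>G :: nat graph. finite_graph G \<and> arrows G F \<and> card (edges G) = size_ramsey F"
  unfolding size_ramsey_def by (rule LeastI_ex) (use ex_arrows[OF assms] in blast)

lemma size_ramsey_le:
  fixes G :: "nat graph"
  assumes "finite_graph G" "arrows G F"
  shows "size_ramsey F \<le> card (edges G)"
  unfolding size_ramsey_def by (rule Least_le) (use assms in blast)

end

theory Submission
  imports Defs "HOL-Analysis.Convex" "HOL-Combinatorics.Permutations" "HOL-Library.Countable"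
begin

text \<open>The host graph is a blow-up of a bounded-degree bipartite expander \<open>H\<close> on \<open>O(n)\<close> vertices:
  each vertex becomes a set of \<open>O(n)\<close> vertices and each edge a complete bipartite graph, which
  makes \<open>O(n\<^sup>3)\<close> edges. In a 2-coloured complete bipartite graph some colour is dense and, after
  passing to subsets of linear size, dense between all large subsets. As \<open>H\<close> is a union of
  boundedly many perfect matchings, this can be arranged for all edges of \<open>H\<close> simultaneously, and it
  induces a 2-colouring of \<open>H\<close>. Small vertex sets of \<open>H\<close> span few edges, so the monochromatic
  components of \<open>H\<close> cannot all be small; a large one contains a walk of length \<open>2 n\<close> that visits
  each vertex boundedly often. The antidiagonals \<open>i + j = l\<close> of the grid, which have at most \<open>n\<close>
  vertices each, are then embedded greedily into the parts along this walk.\<close>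

subsection \<open>Dense pairs\<close>

text \<open>A grid edge joins consecutive antidiagonals, so following \<open>i + j\<close> along a
  walk maps the grid homomorphically into \<open>H\<close>, and density matters only between
  consecutive parts of the walk. The map into \<open>H\<close> may be far from injective: a part is
  revisited harmlessly as long as its total load is a small fraction of its size. Hence a large
  component is enough, and no long monochromatic path has to be found. The obstacle is that the
  number of parts grows with \<open>n\<close> while the parts must stay of linear size. A regular
  partition for all parts at once would lose too much, so pairs are cleaned one by one, and the
  bounded degree of \<open>H\<close> limits how often a part shrinks. What survives is a lower bound
  on densities, which is all that an embedding uses. No constant depends on \<open>n\<close>. The
  bound obtained is therefore cubic up to a constant factor, and the \<epsilon> of the final
  statement only absorbs that factor.\<close>

definition pairs :: "('a \<Rightarrow> 'b \<Rightarrow> bool) \<Rightarrow> 'a set \<Rightarrow> 'b set \<Rightarrow> ('a \<times> 'b) set" where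
  "pairs E A B = {(x, y). x \<in> A \<and> y \<in> B \<and> E x y}"

text \<open>One-sided regularity: large subpairs have density at least \<delta>, with no upper
  bound. Largeness is relative to the sides, so passing to subsets rescales \<rho>.\<close>

definition dense :: "real \<Rightarrow> real \<Rightarrow> ('a \<Rightarrow> 'b \<Rightarrow> bool) \<Rightarrow> 'a set \<Rightarrow> 'b set \<Rightarrow> bool" where
  "dense \<rho> \<delta> E A B \<longleftrightarrow>
     (\<forall>X\<subseteq>A. \<forall>Y\<subseteq>B. real (card X) \<ge> \<rho> * card A \<longrightarrow> real (card Y) \<ge> \<rho> * card B \<longrightarrow>
        real (card (pairs E X Y)) \<ge> \<delta> * card X * card Y)"

lemma finite_pairs: "finite A \<Longrightarrow> finite B \<Longrightarrow> finite (pairs E A B)"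
  by (rule finite_subset[of _ "A \<times> B"]) (auto simp: pairs_def)

lemma card_pairs_le: "finite A \<Longrightarrow> finite B \<Longrightarrow> card (pairs E A B) \<le> card A * card B"
  using card_mono[of "A \<times> B" "pairs E A B"] by (auto simp: pairs_def card_cartesian_product)

lemma dense_subset:
  assumes "dense (\<rho> * \<kappa>) \<delta> E A B" "A' \<subseteq> A" "B' \<subseteq> B" "0 \<le> \<rho>"
    "real (card A') \<ge> \<kappa> * card A" "real (card B') \<ge> \<kappa> * card B"
  shows "dense \<rho> \<delta> E A' B'"
  unfolding dense_def
proof (intro allI impI)
  fix X Y
  assume *: "X \<subseteq> A'" "Y \<subseteq> B'" "\<rho> * card A' \<le> real (card X)" "\<rho> * card B' \<le> real (card Y)"
  have "\<rho> * \<kappa> * card A \<le> \<rho> * card A'" "\<rho> * \<kappa> * card B \<le> \<rho> * card B'"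
    using assms(4-6) by (simp_all add: mult.assoc mult_left_mono)
  with * have "\<rho> * \<kappa> * card A \<le> card X" "\<rho> * \<kappa> * card B \<le> card Y"
    by linarith+
  moreover have "X \<subseteq> A" "Y \<subseteq> B"
    using * assms(2,3) by auto
  ultimately show "\<delta> * card X * card Y \<le> card (pairs E X Y)"
    using assms(1)[unfolded dense_def, THEN spec, THEN mp, THEN spec, THEN mp, THEN mp, THEN mp] by simp
qed

lemma card_pairs_swap: "card (pairs E X Y) = card (pairs (\<lambda>x y. E y x) Y X)"
  by (rule bij_betw_same_card[of prod.swap])
     (auto simp: pairs_def bij_betw_def inj_on_def image_iff)

lemma dense_swap: "dense \<rho> \<delta> E A B \<Longrightarrow> dense \<rho> \<delta> (\<lambda>x y. E y x) B A"
  unfolding dense_def by (subst card_pairs_swap) (simp add: mult_ac)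

text \<open>The right-hand side is the tangent at \<open>t = 1\<close> of a concave power.\<close>

lemma powr_le_linear:
  fixes t a :: real
  assumes "0 \<le> t" "0 < a" "a \<le> 1"
  shows "t powr a \<le> a * t + (1 - a)"
  using assms Youngs_inequality_0[of a "1 - a" t 1] by (cases "t = 0") auto

text \<open>The expression tends to 0 with \<gamma>. It is the loss that the choice of weight causes
  in the estimate for sparse spots, where it must be small compared with \<rho>.\<close>

lemma ex_exponent:
  fixes \<rho> :: real
  assumes "0 < \<rho>"
  shows "\<exists>\<gamma>>0. \<gamma> \<le> 1/4 \<and> \<gamma> + \<rho> powr (-\<gamma>) - 1 \<le> \<rho> / 4"
proof -
  have "((\<lambda>\<gamma>. \<gamma> + \<rho> powr (-\<gamma>) - 1) \<longlongrightarrow> 0 + \<rho> powr (-0) - 1) (at_right 0)"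
    using assms by (intro tendsto_intros) auto
  then have "((\<lambda>\<gamma>. \<gamma> + \<rho> powr (-\<gamma>) - 1) \<longlongrightarrow> 0) (at_right 0)"
    using assms by simp
  then have "\<forall>\<^sub>F \<gamma> in at_right 0. \<gamma> + \<rho> powr (-\<gamma>) - 1 < \<rho> / 4"
    using assms by (intro order_tendstoD) auto
  moreover have "\<forall>\<^sub>F \<gamma> in at_right (0::real). \<gamma> < 1/4"
    by (intro eventually_at_right_less eventually_at_rightI[of 0 "1/4"]) auto
  moreover have "\<forall>\<^sub>F \<gamma> in at_right (0::real). 0 < \<gamma>"
    by (rule eventually_at_right_less)
  ultimately have "\<forall>\<^sub>F \<gamma> in at_right 0. 0 < \<gamma> \<and> \<gamma> \<le> 1/4 \<and> \<gamma> + \<rho> powr (-\<gamma>) - 1 \<le> \<rho> / 4"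
    by eventually_elim auto
  then show ?thesis
    using eventually_happens'[OF trivial_limit_at_right_real] by blast
qed

text \<open>The subpair is one that maximises \<open>e / (a * b) powr (1 - \<gamma>)\<close>, where \<open>e\<close> is its number of edges
  and \<open>a\<close>, \<open>b\<close> are the sizes of its two sides. The weight \<open>1 - \<gamma>\<close> penalises small sides, and a
  sparse spot inside the maximiser would force more edges on the rest than maximality permits.\<close>

lemma dense_pair:
  fixes \<rho> :: real
  assumes "0 < \<rho>" "\<rho> \<le> 1"
  shows "\<exists>\<kappa>::real. 0 < \<kappa> \<and> \<kappa> \<le> 1 \<and> (\<forall>(E :: 'a \<Rightarrow> 'b \<Rightarrow> bool) A B.
     finite A \<longrightarrow> finite B \<longrightarrow> A \<noteq> {} \<longrightarrow> B \<noteq> {} \<longrightarrow>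
     card A * card B \<le> 2 * card (pairs E A B) \<longrightarrow>
     (\<exists>A'\<subseteq>A. \<exists>B'\<subseteq>B. real (card A') \<ge> \<kappa> * card A \<and> real (card B') \<ge> \<kappa> * card B \<and>
        dense \<rho> (1/4) E A' B'))"
proof -
  obtain \<gamma> where \<gamma>: "0 < \<gamma>" "\<gamma> \<le> 1/4" "\<gamma> + \<rho> powr (-\<gamma>) - 1 \<le> \<rho> / 4"
    using ex_exponent assms(1) by blast
  \<comment> \<open>Comparing the maximiser with \<open>(A, B)\<close> itself will show that
    \<open>(a * b) powr \<gamma>\<close> is at least half of
    \<open>(card A * card B) powr \<gamma>\<close>. With \<open>\<kappa> powr \<gamma> = 1/2\<close>
    this bounds the shrinkage of the product, hence of each side.\<close>
  define \<kappa> :: real where "\<kappa> = (1/2) powr (1/\<gamma>)"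
  have \<kappa>: "0 < \<kappa>" "\<kappa> \<le> 1" "\<kappa> powr \<gamma> = 1/2"
    using \<gamma> by (auto simp: \<kappa>_def powr_powr powr_le1)
  have "\<exists>A'\<subseteq>A. \<exists>B'\<subseteq>B. real (card A') \<ge> \<kappa> * card A \<and> real (card B') \<ge> \<kappa> * card B \<and>
        dense \<rho> (1/4) E A' B'"
    if fin: "finite A" "finite B" and ne: "A \<noteq> {}" "B \<noteq> {}"
      and half: "card A * card B \<le> 2 * card (pairs E A B)" for E :: "'a \<Rightarrow> 'b \<Rightarrow> bool" and A B
  proof -
    define e where "e X Y = real (card (pairs E X Y))" for X Y
    define w where "w X Y = (real (card X) * real (card Y)) powr (1 - \<gamma>)" for X :: "'a set" and Y :: "'b set"
    define S where "S = (Pow A - {{}}) \<times> (Pow B - {{}})"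
    have "finite S" "S \<noteq> {}"
      unfolding S_def using fin ne by simp_all blast
    define g where "g = (\<lambda>(X, Y). e X Y / w X Y)"
    have "Max (g ` S) \<in> g ` S"
      using \<open>finite S\<close> \<open>S \<noteq> {}\<close> by (intro Max_in) auto
    then obtain p where p: "p \<in> S" "g p = Max (g ` S)"
      by auto
    then have p_max: "g q \<le> g p" if "q \<in> S" for q
      using \<open>finite S\<close> that by simp
    obtain A' B' where AB': "p = (A', B')" by fastforce
    define F where "F = e A' B' / w A' B'"
    have sub: "A' \<subseteq> A" "B' \<subseteq> B" and ne': "A' \<noteq> {}" "B' \<noteq> {}"
      using p(1) by (auto simp: AB' S_def)
    have fin': "finite A'" "finite B'"
      using sub fin finite_subset by blast+
    define a b where "a = real (card A')" and "b = real (card B')"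
    have ab: "a > 0" "b > 0" "a \<le> card A" "b \<le> card B"
      using ne' fin' sub fin by (auto simp: a_def b_def card_gt_0_iff card_mono)
    have AB: "real (card A) > 0" "real (card B) > 0"
      using ab by linarith+
    have max: "e X Y \<le> F * w X Y" if "X \<subseteq> A" "Y \<subseteq> B" for X Y
    proof (cases "X = {} \<or> Y = {}")
      case True
      then show ?thesis by (auto simp: e_def w_def pairs_def)
    next
      case False
      then have "card X > 0 \<and> card Y > 0"
        using that fin by (simp add: card_gt_0_iff finite_subset)
      then have "w X Y > 0"
        by (simp add: w_def)
      moreover have "e X Y / w X Y \<le> F"
        using p_max[of "(X, Y)"] False that by (auto simp: S_def F_def AB' g_def)
      ultimately show ?thesis
        by (simp add: divide_le_eq)
    qed
    have w': "w A' B' > 0"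
      using ab by (simp add: w_def a_def b_def)
    have eF: "e A' B' = F * w A' B'"
      using w' by (simp add: F_def)
    have F: "F = e A' B' / (a * b) * (a * b) powr \<gamma>"
    proof -
      have "(a * b) powr (1 - \<gamma>) * (a * b) powr \<gamma> = a * b"
        using ab by (simp flip: powr_add)
      then show ?thesis
        using w' ab by (simp add: F_def w_def a_def[symmetric] b_def[symmetric] field_simps)
    qed
    have F_ge: "F \<ge> 1/2 * (card A * card B) powr \<gamma>"
    proof -
      have "e A B \<ge> 1/2 * (real (card A) * real (card B))"
        using half unfolding e_def by (simp flip: of_nat_mult)
      moreover have "e A B \<le> F * w A B"
        by (rule max) auto
      ultimately have le: "1/2 * (real (card A) * real (card B)) \<le> F * w A B"
        by linarith
      have "real (card A) * real (card B) = w A B * (card A * card B) powr \<gamma>"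
        using AB by (simp add: w_def flip: powr_add)
      with le have "w A B * (1/2 * (card A * card B) powr \<gamma>) \<le> w A B * F"
        by (simp only: mult.commute[of F] mult.left_commute[of "w A B"])
      moreover have "w A B > 0"
        using AB by (simp add: w_def)
      ultimately show ?thesis
        by (simp only: mult_le_cancel_left_pos)
    qed
    have e_le: "e A' B' \<le> a * b"
      using card_pairs_le[OF fin', of E] by (simp add: e_def a_def b_def flip: of_nat_mult)
    have "F \<le> (a * b) powr \<gamma>"
      unfolding F using e_le ab by (intro mult_left_le_one_le) (auto simp: e_def)
    moreover have "(\<kappa> * (card A * card B)) powr \<gamma> = 1/2 * (card A * card B) powr \<gamma>"
      using \<kappa> by (simp add: powr_mult)
    ultimately have "(\<kappa> * (card A * card B)) powr \<gamma> \<le> (a * b) powr \<gamma>"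
      using F_ge by linarith
    then have size: "\<kappa> * (card A * card B) \<le> a * b"
      using powr_less_mono2[of \<gamma> "a * b" "\<kappa> * (card A * card B)"] ab \<gamma> by (smt (verit) mult_pos_pos)
    have sizeA: "a \<ge> \<kappa> * card A"
    proof -
      have "a * b \<le> a * card B"
        using ab by (intro mult_left_mono) auto
      with size have "\<kappa> * card A * card B \<le> a * card B"
        by (simp add: mult.assoc)
      then show ?thesis
        by (rule mult_right_le_imp_le) (use AB in simp)
    qed
    have sizeB: "b \<ge> \<kappa> * card B"
    proof -
      have "a * b \<le> card A * b"
        using ab by (intro mult_right_mono) auto
      with size have "card A * (\<kappa> * card B) \<le> card A * b"
        by (simp add: mult_ac)
      then show ?thesis
        by (rule mult_left_le_imp_le) (use AB in simp)
    qed
    \<comment> \<open>\<open>F\<close> is the density of the maximiser times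
      \<open>(a * b) powr \<gamma>\<close>. Smaller sides lower the second factor, so the density
      cannot fall below the initial 1/2.\<close>
    have e_ge: "e A' B' \<ge> 1/2 * (a * b)"
    proof -
      have "(a * b) powr \<gamma> \<le> (card A * card B) powr \<gamma>"
        using ab \<gamma> by (intro powr_mono2) (auto intro!: mult_mono)
      then have "1/2 * (a * b) powr \<gamma> \<le> e A' B' / (a * b) * (a * b) powr \<gamma>"
        using F_ge F by simp
      then have "1/2 \<le> e A' B' / (a * b)"
        using ab by (metis mult_le_cancel_right_pos mult_pos_pos powr_gt_zero less_irrefl)
      then show ?thesis
        using ab by (simp add: field_simps)
    qed
    have "dense \<rho> (1/4) E A' B'"
      unfolding dense_def
    proof (intro allI impI)
      fix X Y
      assume X: "X \<subseteq> A'" and Y: "Y \<subseteq> B'"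
        and "\<rho> * card A' \<le> real (card X)" "\<rho> * card B' \<le> real (card Y)"
      define x y where "x = card X / a" and "y = card Y / b"
      have finXY: "finite X" "finite Y"
        using X Y fin' finite_subset by blast+
      have x: "\<rho> \<le> x" "x \<le> 1" "card X = x * a" and y: "\<rho> \<le> y" "y \<le> 1" "card Y = y * b"
        using \<open>\<rho> * card A' \<le> real (card X)\<close> \<open>\<rho> * card B' \<le> real (card Y)\<close> ab card_mono[OF fin'(1) X] card_mono[OF fin'(2) Y]
        by (auto simp: x_def y_def a_def b_def field_simps)
      have x0: "0 < x" "0 < y" using x y assms by linarith+
      have cX: "real (card (A' - X)) = (1 - x) * a" and cY: "real (card (B' - Y)) = (1 - y) * b"
        using x(3) y(3) card_Diff_subset[OF finXY(1) X] card_Diff_subset[OF finXY(2) Y] card_mono[OF fin'(1) X] card_mono[OF fin'(2) Y]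
        by (auto simp: a_def b_def algebra_simps of_nat_diff)
      \<comment> \<open>Maximality only yields upper bounds. They are applied to the two rectangles
        that make up the complement of \<open>X \<times> Y\<close>, and a lower bound for
        \<open>e X Y\<close> remains.\<close>
      have split: "e A' B' \<le> e (A' - X) B' + e X (B' - Y) + e X Y"
      proof -
        have "pairs E A' B' \<subseteq> pairs E (A' - X) B' \<union> pairs E X (B' - Y) \<union> pairs E X Y"
          by (auto simp: pairs_def)
        then have "card (pairs E A' B') \<le> card (pairs E (A' - X) B' \<union> pairs E X (B' - Y) \<union> pairs E X Y)"
          using fin' finXY by (intro card_mono) (auto intro!: finite_pairs)
        also have "\<dots> \<le> card (pairs E (A' - X) B') + card (pairs E X (B' - Y)) + card (pairs E X Y)"
          by (meson card_Un_le le_trans add_le_mono1)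
        finally show ?thesis by (simp add: e_def)
      qed
      have F0: "F \<ge> 0" using w' by (simp add: F_def e_def)
      have e0: "e A' B' \<ge> 0" by (simp add: e_def)
      have "e (A' - X) B' \<le> F * w (A' - X) B'"
        using sub X by (intro max) auto
      also have "w (A' - X) B' = (1 - x) powr (1 - \<gamma>) * w A' B'"
        using x ab by (simp add: w_def cX powr_mult a_def[symmetric] b_def[symmetric])
      also have "F * ((1 - x) powr (1 - \<gamma>) * w A' B') = e A' B' * (1 - x) powr (1 - \<gamma>)"
        by (simp add: eF)
      also have "\<dots> \<le> e A' B' * ((1 - \<gamma>) * (1 - x) + (1 - (1 - \<gamma>)))"
        using e0 x \<gamma> by (intro mult_left_mono powr_le_linear) auto
      finally have 1: "e (A' - X) B' \<le> e A' B' * (1 - (1 - \<gamma>) * x)"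
        by (simp add: algebra_simps)
      have "e X (B' - Y) \<le> F * w X (B' - Y)"
        using sub X by (intro max) auto
      also have "w X (B' - Y) = x powr (1 - \<gamma>) * (1 - y) powr (1 - \<gamma>) * w A' B'"
        using x y ab x0 by (simp add: w_def cY powr_mult a_def[symmetric] b_def[symmetric])
      also have "F * (x powr (1 - \<gamma>) * (1 - y) powr (1 - \<gamma>) * w A' B') = e A' B' * (x powr (1 - \<gamma>) * (1 - y) powr (1 - \<gamma>))"
        by (simp add: eF)
      \<comment> \<open>The tangent bound for \<open>x powr (1 - \<gamma>)\<close> would leave a
        term without the factor \<open>x\<close>, but the final estimate must be proportional to
        \<open>x\<close>. The assumption \<open>\<rho> \<le> x\<close> gives a multiple of
        \<open>x\<close> instead.\<close>
      also have "\<dots> \<le> e A' B' * ((x * \<rho> powr (-\<gamma>)) * ((1 - \<gamma>) * (1 - y) + (1 - (1 - \<gamma>))))"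
      proof (intro mult_left_mono mult_mono powr_le_linear)
        have "x powr (1 - \<gamma>) = x * x powr (-\<gamma>)"
          using x0 by (simp add: powr_diff powr_minus divide_inverse)
        also have "\<dots> \<le> x * \<rho> powr (-\<gamma>)"
          using x0 x assms \<gamma> by (intro mult_left_mono powr_mono2') auto
        finally show "x powr (1 - \<gamma>) \<le> x * \<rho> powr (-\<gamma>)" .
      qed (use e0 x0 y \<gamma> in auto)
      finally have 2: "e X (B' - Y) \<le> e A' B' * (x * (\<rho> powr (-\<gamma>) * (1 - (1 - \<gamma>) * y)))"
        by (simp add: algebra_simps)
      define c where "c = \<rho> powr (-\<gamma>)"
      have c1: "c \<ge> 1"
        unfolding c_def using assms \<gamma> powr_mono2'[of "-\<gamma>" \<rho> 1] by simp
      \<comment> \<open>By \<open>c \<ge> 1\<close> and \<open>\<gamma> \<le> 1/4\<close> the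
        left-hand side is at least \<open>3/4 * y - (\<gamma> + c - 1)\<close>, and the choice of
        \<gamma> bounds the subtracted term by \<open>\<rho> / 4 \<le> y / 4\<close>.\<close>
      have num: "(1 - \<gamma>) - c * (1 - (1 - \<gamma>) * y) \<ge> y / 2"
      proof -
        have "c * ((1 - \<gamma>) * y) \<ge> 1 * ((1 - \<gamma>) * y)"
          using c1 \<gamma> x0 by (intro mult_right_mono) auto
        moreover have "\<gamma> * y \<le> 1/4 * y"
          using \<gamma> x0 by (intro mult_right_mono) auto
        ultimately show ?thesis
          using \<gamma>(3) y(1) unfolding c_def[symmetric] by (simp add: algebra_simps)
      qed
      have "e X Y \<ge> e A' B' * (x * ((1 - \<gamma>) - c * (1 - (1 - \<gamma>) * y)))"
        using split 1 2 unfolding c_def[symmetric] by (simp add: algebra_simps)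
      moreover have "e A' B' * (x * ((1 - \<gamma>) - c * (1 - (1 - \<gamma>) * y))) \<ge> e A' B' * (x * (y / 2))"
        using num e0 x0 by (intro mult_left_mono) auto
      moreover have "e A' B' * (x * (y / 2)) \<ge> 1/2 * (a * b) * (x * (y / 2))"
        using e_ge x0 by (intro mult_right_mono) auto
      ultimately have "e X Y \<ge> 1/4 * (x * a) * (y * b)"
        by (simp add: algebra_simps)
      then show "1/4 * real (card X) * real (card Y) \<le> real (card (pairs E X Y))"
        by (simp add: x y e_def)
    qed
    with sub sizeA sizeB show ?thesis
      unfolding a_def b_def by blast
  qed
  note main = this
  show ?thesis
    by (intro exI[of _ \<kappa>] conjI allI impI \<kappa> main)
qed

lemma dense_monochromatic_pair:
  fixes \<rho> :: real
  assumes "0 < \<rho>" "\<rho> \<le> 1"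
  shows "\<exists>\<kappa>::real. 0 < \<kappa> \<and> \<kappa> \<le> 1 \<and> (\<forall>(col :: 'a \<Rightarrow> 'b \<Rightarrow> bool) A B.
     finite A \<longrightarrow> finite B \<longrightarrow> A \<noteq> {} \<longrightarrow> B \<noteq> {} \<longrightarrow>
     (\<exists>A'\<subseteq>A. \<exists>B'\<subseteq>B. \<exists>k. real (card A') \<ge> \<kappa> * card A \<and> real (card B') \<ge> \<kappa> * card B \<and>
        dense \<rho> (1/4) (\<lambda>x y. col x y = k) A' B'))"
proof -
  obtain \<kappa> :: real where \<kappa>: "0 < \<kappa>" "\<kappa> \<le> 1" and *: "\<And>(E :: 'a \<Rightarrow> 'b \<Rightarrow> bool) A B.
     finite A \<Longrightarrow> finite B \<Longrightarrow> A \<noteq> {} \<Longrightarrow> B \<noteq> {} \<Longrightarrow>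
     card A * card B \<le> 2 * card (pairs E A B) \<Longrightarrow>
     \<exists>A'\<subseteq>A. \<exists>B'\<subseteq>B. real (card A') \<ge> \<kappa> * card A \<and> real (card B') \<ge> \<kappa> * card B \<and>
        dense \<rho> (1/4) E A' B'"
    using dense_pair[OF assms] by metis
  have "\<exists>A'\<subseteq>A. \<exists>B'\<subseteq>B. \<exists>k. real (card A') \<ge> \<kappa> * card A \<and> real (card B') \<ge> \<kappa> * card B \<and>
        dense \<rho> (1/4) (\<lambda>x y. col x y = k) A' B'"
    if fin: "finite A" "finite B" and ne: "A \<noteq> {}" "B \<noteq> {}" for col :: "'a \<Rightarrow> 'b \<Rightarrow> bool" and A B
  proof -
    have "A \<times> B = pairs (\<lambda>x y. col x y = True) A B \<union> pairs (\<lambda>x y. col x y = False) A B"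
      by (auto simp: pairs_def)
    then have "card A * card B \<le> card (pairs (\<lambda>x y. col x y = True) A B) + card (pairs (\<lambda>x y. col x y = False) A B)"
      by (metis card_Un_le card_cartesian_product)
    then have "\<exists>k. card A * card B \<le> 2 * card (pairs (\<lambda>x y. col x y = k) A B)"
      by (cases "card (pairs (\<lambda>x y. col x y = True) A B) \<ge> card (pairs (\<lambda>x y. col x y = False) A B)")
         (rule exI[of _ True], linarith, rule exI[of _ False], linarith)
    then obtain k where "card A * card B \<le> 2 * card (pairs (\<lambda>x y. col x y = k) A B)" ..
    from *[OF fin ne this] show ?thesis by blast
  qed
  note main = this
  show ?thesis
    by (intro exI[of _ \<kappa>] conjI allI impI \<kappa> main)
qed

text \<open>The matchings are treated one after the other. Since each vertex lies in one edge per matching,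
  the total shrinkage in the later steps is at most a constant \<open>\<kappa>\<close> known in advance, so
  \<open>\<rho> * \<kappa>\<close>-density at the present step leaves \<open>\<rho>\<close>-density at the end.\<close>

lemma dense_along_matchings:
  fixes \<rho> :: real
  assumes "0 < \<rho>" "\<rho> \<le> 1"
  shows "\<exists>\<kappa>::real. 0 < \<kappa> \<and> \<kappa> \<le> 1 \<and> (\<forall>(col :: 'a \<Rightarrow> 'b \<Rightarrow> bool) (A :: nat \<Rightarrow> 'a set) B (\<pi> :: nat \<Rightarrow> nat \<Rightarrow> nat).
     (\<forall>x. finite (A x) \<and> finite (B x) \<and> A x \<noteq> {} \<and> B x \<noteq> {}) \<longrightarrow>
     (\<forall>i<d. bij (\<pi> i)) \<longrightarrow>
     (\<exists>A' B' c. (\<forall>x. A' x \<subseteq> A x \<and> B' x \<subseteq> B x \<and>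
          real (card (A' x)) \<ge> \<kappa> * card (A x) \<and> real (card (B' x)) \<ge> \<kappa> * card (B x)) \<and>
        (\<forall>i<d. \<forall>x. dense \<rho> (1/4) (\<lambda>u v. col u v = c i x) (A' x) (B' (\<pi> i x)))))"
proof (induction d)
  case 0
  show ?case
    by (rule exI[of _ 1]) auto
next
  case (Suc d)
  then obtain \<kappa> :: real where \<kappa>: "0 < \<kappa>" "\<kappa> \<le> 1" and
    IH: "\<forall>(col :: 'a \<Rightarrow> 'b \<Rightarrow> bool) (A :: nat \<Rightarrow> 'a set) B (\<pi> :: nat \<Rightarrow> nat \<Rightarrow> nat).
     (\<forall>x. finite (A x) \<and> finite (B x) \<and> A x \<noteq> {} \<and> B x \<noteq> {}) \<longrightarrow>
     (\<forall>i<d. bij (\<pi> i)) \<longrightarrow>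
     (\<exists>A' B' c. (\<forall>x. A' x \<subseteq> A x \<and> B' x \<subseteq> B x \<and>
          real (card (A' x)) \<ge> \<kappa> * card (A x) \<and> real (card (B' x)) \<ge> \<kappa> * card (B x)) \<and>
        (\<forall>i<d. \<forall>x. dense \<rho> (1/4) (\<lambda>u v. col u v = c i x) (A' x) (B' (\<pi> i x))))"
    by (elim exE conjE) (rule that)
  have "0 < \<rho> * \<kappa>" "\<rho> * \<kappa> \<le> 1"
    using assms \<kappa> by (auto intro: mult_le_one)
  from dense_monochromatic_pair[OF this] obtain \<mu> :: real where \<mu>: "0 < \<mu>" "\<mu> \<le> 1"
    and pair: "\<And>(col :: 'a \<Rightarrow> 'b \<Rightarrow> bool) A B.
     finite A \<Longrightarrow> finite B \<Longrightarrow> A \<noteq> {} \<Longrightarrow> B \<noteq> {} \<Longrightarrow>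
     \<exists>A'\<subseteq>A. \<exists>B'\<subseteq>B. \<exists>k. real (card A') \<ge> \<mu> * card A \<and> real (card B') \<ge> \<mu> * card B \<and>
        dense (\<rho> * \<kappa>) (1/4) (\<lambda>x y. col x y = k) A' B'"
    by metis
  have "\<exists>A' B' c. (\<forall>x. A' x \<subseteq> A x \<and> B' x \<subseteq> B x \<and>
          real (card (A' x)) \<ge> \<kappa> * \<mu> * card (A x) \<and> real (card (B' x)) \<ge> \<kappa> * \<mu> * card (B x)) \<and>
        (\<forall>i<Suc d. \<forall>x. dense \<rho> (1/4) (\<lambda>u v. col u v = c i x) (A' x) (B' (\<pi> i x)))"
    if AB: "\<forall>x. finite (A x) \<and> finite (B x) \<and> A x \<noteq> {} \<and> B x \<noteq> {}"
      and \<pi>: "\<forall>i<Suc d. bij (\<pi> i)"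
    for col :: "'a \<Rightarrow> 'b \<Rightarrow> bool" and A B and \<pi> :: "nat \<Rightarrow> nat \<Rightarrow> nat"
  proof -
    have "\<exists>S T k. S \<subseteq> A x \<and> T \<subseteq> B (\<pi> d x) \<and> real (card S) \<ge> \<mu> * card (A x) \<and>
        real (card T) \<ge> \<mu> * card (B (\<pi> d x)) \<and> dense (\<rho> * \<kappa>) (1/4) (\<lambda>x y. col x y = k) S T" for x
      using pair[of "A x" "B (\<pi> d x)" col] AB by blast
    then obtain S T k where STk: "\<And>x. S x \<subseteq> A x" "\<And>x. T x \<subseteq> B (\<pi> d x)"
        "\<And>x. real (card (S x)) \<ge> \<mu> * card (A x)" "\<And>x. real (card (T x)) \<ge> \<mu> * card (B (\<pi> d x))"
        "\<And>x. dense (\<rho> * \<kappa>) (1/4) (\<lambda>u v. col u v = k x) (S x) (T x)"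
      by metis
    \<comment> \<open>Each right index lies in exactly one edge of the matching, so the sets chosen
      edge by edge give one new part per index.\<close>
    define T' where "T' y = T (inv (\<pi> d) y)" for y
    have inv: "\<pi> d (inv (\<pi> d) y) = y" "inv (\<pi> d) (\<pi> d y) = y" for y
      using \<pi> by (simp_all add: bij_is_surj surj_f_inv_f bij_is_inj inv_f_f)
    have T': "T' y \<subseteq> B y" "real (card (T' y)) \<ge> \<mu> * card (B y)" for y
      using STk(2)[of "inv (\<pi> d) y"] STk(4)[of "inv (\<pi> d) y"] by (simp_all add: T'_def inv)
    have "card (A x) > 0" "card (B x) > 0" for x
      using AB by (simp_all add: card_gt_0_iff)
    then have "real (card (S x)) > 0" "real (card (T' x)) > 0" for x
      using STk(3)[of x] T'(2)[of x] \<mu>(1) by (smt (verit) mult_pos_pos of_nat_0_less_iff)+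
    then have ne: "finite (S x) \<and> finite (T' x) \<and> S x \<noteq> {} \<and> T' x \<noteq> {}" for x
      by (metis card_gt_0_iff of_nat_0_less_iff)
    have "\<exists>A' B' c. (\<forall>x. A' x \<subseteq> S x \<and> B' x \<subseteq> T' x \<and>
          real (card (A' x)) \<ge> \<kappa> * card (S x) \<and> real (card (B' x)) \<ge> \<kappa> * card (T' x)) \<and>
        (\<forall>i<d. \<forall>x. dense \<rho> (1/4) (\<lambda>u v. col u v = c i x) (A' x) (B' (\<pi> i x)))"
      by (rule IH[THEN spec, THEN spec, THEN spec, THEN spec, THEN mp, THEN mp]) (use ne \<pi> in auto)
    then obtain A' B' c where sub: "\<And>x. A' x \<subseteq> S x" "\<And>x. B' x \<subseteq> T' x"
        and size: "\<And>x. real (card (A' x)) \<ge> \<kappa> * card (S x)" "\<And>x. real (card (B' x)) \<ge> \<kappa> * card (T' x)"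
        and c: "\<And>i x. i < d \<Longrightarrow> dense \<rho> (1/4) (\<lambda>u v. col u v = c i x) (A' x) (B' (\<pi> i x))"
      by blast
    define c' where "c' i x = (if i = d then k x else c i x)" for i x
    have "dense \<rho> (1/4) (\<lambda>u v. col u v = c' i x) (A' x) (B' (\<pi> i x))" if "i < Suc d" for i x
    proof (cases "i = d")
      case True
      have "B' (\<pi> d x) \<subseteq> T x" "real (card (B' (\<pi> d x))) \<ge> \<kappa> * card (T x)"
        using sub(2)[of "\<pi> d x"] size(2)[of "\<pi> d x"] by (simp_all add: T'_def inv)
      then show ?thesis
        using dense_subset[OF STk(5)] sub(1) size(1) assms(1) True by (simp add: c'_def)
    next
      case False
      then show ?thesis
        using c that by (simp add: c'_def)
    qed
    moreover have "real (card (A' x)) \<ge> \<kappa> * \<mu> * card (A x)" for x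
      using size(1)[of x] mult_left_mono[OF STk(3)[of x] less_imp_le[OF \<kappa>(1)]] by (simp add: mult.assoc)
    moreover have "real (card (B' x)) \<ge> \<kappa> * \<mu> * card (B x)" for x
      using size(2)[of x] mult_left_mono[OF T'(2)[of x] less_imp_le[OF \<kappa>(1)]] by (simp add: mult.assoc)
    moreover have "A' x \<subseteq> A x" "B' x \<subseteq> B x" for x
      using sub STk(1) T'(1) by blast+
    ultimately show ?thesis
      by (intro exI[of _ A'] exI[of _ B'] exI[of _ c']) simp
  qed
  note main = this
  have "\<kappa> * \<mu> > 0" "\<kappa> * \<mu> \<le> 1"
    using \<kappa> \<mu> by (auto intro: mult_le_one)
  then show ?case
    by (intro exI[of _ "\<kappa> * \<mu>"] conjI) (assumption | (intro allI impI, rule main))+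
qed

subsection \<open>Greedy embedding\<close>

text \<open>Otherwise the exceptional vertices would form with \<open>Y\<close> a subpair that is
  large on both sides but too sparse.\<close>

lemma dense_few_bad:
  assumes "dense \<rho> \<delta> E A B" "finite A" "finite B" "Y \<subseteq> B" "0 < \<rho>"
    "real (card Y) \<ge> \<rho> * card B"
  shows "real (card {x \<in> A. real (card {y \<in> Y. E x y}) < \<delta> * card Y}) \<le> \<rho> * card A"
proof (rule ccontr)
  define X where "X = {x \<in> A. real (card {y \<in> Y. E x y}) < \<delta> * card Y}"
  assume "\<not> ?thesis"
  then have X: "real (card X) > \<rho> * card A"
    by (simp add: X_def)
  have "finite X" "finite Y"
    using assms(2-4) by (auto simp: X_def intro: finite_subset)
  have "real (card X) > 0"
    using X assms(5) by (smt (verit) mult_nonneg_nonneg of_nat_0_le_iff)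
  then have "X \<noteq> {}" by auto
  have "pairs E X Y = Sigma X (\<lambda>x. {y \<in> Y. E x y})"
    by (auto simp: pairs_def)
  then have "real (card (pairs E X Y)) = (\<Sum>x\<in>X. real (card {y \<in> Y. E x y}))"
    using \<open>finite X\<close> \<open>finite Y\<close> by simp
  also have "\<dots> < (\<Sum>x\<in>X. \<delta> * card Y)"
    using \<open>finite X\<close> \<open>X \<noteq> {}\<close> by (intro sum_strict_mono) (auto simp: X_def)
  also have "\<dots> = \<delta> * card X * card Y"
    by simp
  also have "\<dots> \<le> card (pairs E X Y)"
    using assms(1,4,6) X unfolding dense_def by (auto simp: X_def)
  finally show False by simp
qed

text \<open>The vertices of \<open>W\<close> are embedded one at a time, in any order. The invariant is that the
  candidate set of a vertex not yet embedded, i.e. the set of admissible images given its embedded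
  neighbours, loses at most a factor \<open>\<delta>\<close> for each of these neighbours.\<close>

lemma greedy_embedding:
  fixes adj :: "'z \<Rightarrow> 'z \<Rightarrow> bool" and E :: "'a \<Rightarrow> 'a \<Rightarrow> bool" and U :: "'h \<Rightarrow> 'a set"
    and \<rho> \<delta> \<sigma> :: real
  assumes W: "finite W" and sym: "\<And>z z'. adj z z' \<Longrightarrow> adj z' z" and irrefl: "\<And>z. \<not> adj z z"
    and deg: "\<And>z. z \<in> W \<Longrightarrow> card {z' \<in> W. adj z z'} \<le> \<Delta>"
    and U: "\<And>z. z \<in> W \<Longrightarrow> finite (U (h z)) \<and> U (h z) \<noteq> {}"
    and disj: "\<And>z z'. z \<in> W \<Longrightarrow> z' \<in> W \<Longrightarrow> h z \<noteq> h z' \<Longrightarrow> U (h z) \<inter> U (h z') = {}"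
    and dense: "\<And>z z'. z \<in> W \<Longrightarrow> z' \<in> W \<Longrightarrow> adj z z' \<Longrightarrow> dense \<rho> \<delta> E (U (h z)) (U (h z'))"
    and Esym: "\<And>a b. E a b \<Longrightarrow> E b a"
    and few: "\<And>z. z \<in> W \<Longrightarrow> real (card {z' \<in> W. h z' = h z}) \<le> \<sigma> * card (U (h z))"
    and num: "0 < \<rho>" "0 < \<delta>" "\<delta> \<le> 1" "\<rho> \<le> \<delta> ^ \<Delta>" "\<Delta> * \<rho> + \<sigma> < \<delta> ^ \<Delta>"
  shows "\<exists>\<phi>. inj_on \<phi> W \<and> (\<forall>z\<in>W. \<phi> z \<in> U (h z)) \<and>
    (\<forall>z\<in>W. \<forall>z'\<in>W. adj z z' \<longrightarrow> E (\<phi> z) (\<phi> z'))"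
proof -
  define C where "C P \<phi> z = {a \<in> U (h z). \<forall>z'\<in>P. adj z z' \<longrightarrow> E (\<phi> z') a}" for P \<phi> z
  define good where "good P \<phi> \<longleftrightarrow> inj_on \<phi> P \<and> (\<forall>z\<in>P. \<phi> z \<in> U (h z)) \<and>
    (\<forall>z\<in>P. \<forall>z'\<in>P. adj z z' \<longrightarrow> E (\<phi> z) (\<phi> z')) \<and>
    (\<forall>z\<in>W - P. real (card (C P \<phi> z)) \<ge> \<delta> ^ card {z' \<in> P. adj z z'} * card (U (h z)))" for P \<phi>
  have deg': "card {z' \<in> P. adj z z'} \<le> \<Delta>" if "P \<subseteq> W" "z \<in> W" for P z
    using card_mono[of "{z' \<in> W. adj z z'}" "{z' \<in> P. adj z z'}"] that W deg[OF that(2)] by fastforce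
  have large: "real (card (C P \<phi> z)) \<ge> \<delta> ^ \<Delta> * card (U (h z))" if "good P \<phi>" "P \<subseteq> W" "z \<in> W - P" for P \<phi> z
  proof -
    have "\<delta> ^ \<Delta> * card (U (h z)) \<le> \<delta> ^ card {z' \<in> P. adj z z'} * card (U (h z))"
      using num deg'[of P z] that by (intro mult_right_mono power_decreasing) auto
    with that show ?thesis by (force simp: good_def)
  qed
  have "\<exists>\<phi>. good P \<phi>" if "P \<subseteq> W" for P
    using finite_subset[OF that W] that
  proof (induction P rule: finite_induct)
    case empty
    show ?case by (auto simp: good_def C_def)
  next
    case (insert z P)
    then obtain \<phi> where \<phi>: "good P \<phi>" by blast
    have z: "z \<in> W" "z \<in> W - P" and P: "P \<subseteq> W" using insert by auto
    \<comment> \<open>An image for \<open>z\<close> is unusable if it shrinks the candidate set of a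
      later neighbour too much (\<open>Bad\<close>) or is taken (\<open>Used\<close>). There are at
      most \<Delta> later neighbours, each excluding a fraction \<rho> of the part, and parts with
      different indices are disjoint, so only vertices with the same \<open>h\<close> compete. The
      condition \<open>\<Delta> * \<rho> + \<sigma> < \<delta> ^ \<Delta>\<close> leaves a candidate
      over.\<close>
    define N where "N = {y \<in> W - insert z P. adj z y}"
    define Bad where "Bad y = {a \<in> U (h z). real (card {b \<in> C P \<phi> y. E a b}) < \<delta> * card (C P \<phi> y)}" for y
    define Used where "Used = \<phi> ` {z' \<in> P. h z' = h z}"
    have uz: "finite (U (h z))" "U (h z) \<noteq> {}" and cuz: "real (card (U (h z))) > 0"
      using U[OF z(1)] by (auto simp: card_gt_0_iff)
    have finN: "finite N"
      using W by (simp add: N_def)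
    have "card N \<le> card {z' \<in> W. adj z z'}"
      using W by (intro card_mono) (auto simp: N_def)
    with deg[OF z(1)] have cN: "card N \<le> \<Delta>" by linarith
    have bad: "real (card (Bad y)) \<le> \<rho> * card (U (h z))" if "y \<in> N" for y
      unfolding Bad_def
    proof (rule dense_few_bad)
      have y: "y \<in> W" "y \<in> W - P" "adj z y" using that by (auto simp: N_def)
      show "dense \<rho> \<delta> E (U (h z)) (U (h y))"
        using dense[OF z(1) y(1) y(3)] .
      show "finite (U (h y))" using U[OF y(1)] by auto
      show "C P \<phi> y \<subseteq> U (h y)" by (auto simp: C_def)
      have "\<rho> * card (U (h y)) \<le> \<delta> ^ \<Delta> * card (U (h y))"
        using num by (intro mult_right_mono) auto
      with large[OF \<phi> P y(2)] show "\<rho> * card (U (h y)) \<le> card (C P \<phi> y)" by linarith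
    qed (use uz num in auto)
    have "card Used \<le> card {z' \<in> W. h z' = h z}"
      unfolding Used_def using insert(1) W P
      by (intro order_trans[OF card_image_le] card_mono) auto
    then have used: "real (card Used) \<le> \<sigma> * card (U (h z))"
      using few[OF z(1)] by linarith
    have "real (card ((\<Union>y\<in>N. Bad y) \<union> Used)) \<le> (\<Sum>y\<in>N. real (card (Bad y))) + card Used"
      using card_Un_le[of "\<Union>y\<in>N. Bad y" Used] card_UN_le[OF finN, of Bad] by (simp flip: of_nat_sum)
    also have "\<dots> \<le> (\<Sum>y\<in>N. \<rho> * card (U (h z))) + \<sigma> * card (U (h z))"
      using bad used by (intro add_mono sum_mono) auto
    also have "\<dots> = (card N * \<rho> + \<sigma>) * card (U (h z))"
      by (simp add: algebra_simps)
    also have "\<dots> \<le> (\<Delta> * \<rho> + \<sigma>) * card (U (h z))"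
      using cN num by (intro mult_right_mono add_right_mono) auto
    also have "\<dots> < \<delta> ^ \<Delta> * card (U (h z))"
      using num cuz by (intro mult_strict_right_mono) auto
    also have "\<dots> \<le> card (C P \<phi> z)"
      using large[OF \<phi> P z(2)] .
    finally have "\<not> C P \<phi> z \<subseteq> (\<Union>y\<in>N. Bad y) \<union> Used"
      using card_mono[of "(\<Union>y\<in>N. Bad y) \<union> Used" "C P \<phi> z"] finN uz insert(1)
      by (fastforce simp: Bad_def Used_def)
    then obtain a where a: "a \<in> C P \<phi> z" "\<And>y. y \<in> N \<Longrightarrow> a \<notin> Bad y" "a \<notin> Used" by blast
    have aU: "a \<in> U (h z)" using a(1) by (auto simp: C_def)
    define \<psi> where "\<psi> = \<phi>(z := a)"
    have \<psi>: "\<psi> z = a" "\<And>y. y \<in> P \<Longrightarrow> \<psi> y = \<phi> y"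
      using insert(2) by (auto simp: \<psi>_def)
    have \<phi>': "inj_on \<phi> P" "\<And>y. y \<in> P \<Longrightarrow> \<phi> y \<in> U (h y)"
      "\<And>y y'. y \<in> P \<Longrightarrow> y' \<in> P \<Longrightarrow> adj y y' \<Longrightarrow> E (\<phi> y) (\<phi> y')"
      "\<And>y. y \<in> W - P \<Longrightarrow> real (card (C P \<phi> y)) \<ge> \<delta> ^ card {z' \<in> P. adj y z'} * card (U (h y))"
      using \<phi> by (auto simp: good_def)
    have "a \<notin> \<phi> ` P"
    proof
      assume "a \<in> \<phi> ` P"
      then obtain y where y: "y \<in> P" "a = \<phi> y" by blast
      then have "h y = h z"
        using disj[of y z] \<phi>'(2)[OF y(1)] aU z P by blast
      with y a(3) show False by (auto simp: Used_def)
    qed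
    then have "inj_on \<psi> (insert z P)"
      using \<phi>'(1) insert(2) \<psi> by (auto simp: inj_on_def image_iff)
    moreover have "\<forall>y\<in>insert z P. \<psi> y \<in> U (h y)"
      using aU \<phi>'(2) \<psi> by auto
    moreover have "\<forall>y\<in>insert z P. \<forall>y'\<in>insert z P. adj y y' \<longrightarrow> E (\<psi> y) (\<psi> y')"
    proof (intro ballI impI)
      fix y y' assume *: "y \<in> insert z P" "y' \<in> insert z P" "adj y y'"
      have az: "E (\<phi> x) a" if "x \<in> P" "adj z x" for x
        using a(1) that by (auto simp: C_def)
      show "E (\<psi> y) (\<psi> y')"
        using * \<phi>'(3) az Esym sym irrefl \<psi> by (metis insert_iff)
    qed
    moreover have "real (card (C (insert z P) \<psi> y)) \<ge> \<delta> ^ card {z' \<in> insert z P. adj y z'} * card (U (h y))"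
      if y: "y \<in> W - insert z P" for y
    proof (cases "adj y z")
      case False
      then have "{z' \<in> insert z P. adj y z'} = {z' \<in> P. adj y z'}" by auto
      moreover have "C (insert z P) \<psi> y = C P \<phi> y"
        using False \<psi> by (auto simp: C_def)
      ultimately show ?thesis using \<phi>'(4)[of y] y by simp
    next
      case True
      then have yN: "y \<in> N" using y sym by (auto simp: N_def)
      have "{z' \<in> insert z P. adj y z'} = insert z {z' \<in> P. adj y z'}" using True by auto
      then have 1: "card {z' \<in> insert z P. adj y z'} = Suc (card {z' \<in> P. adj y z'})"
        using insert(1,2) by simp
      have 2: "C (insert z P) \<psi> y = {b \<in> C P \<phi> y. E a b}"
        using True \<psi> by (auto simp: C_def)
      have "\<delta> * (\<delta> ^ card {z' \<in> P. adj y z'} * card (U (h y))) \<le> \<delta> * card (C P \<phi> y)"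
        using \<phi>'(4)[of y] y num by (intro mult_left_mono) auto
      also have "\<dots> \<le> card {b \<in> C P \<phi> y. E a b}"
        using a(2)[OF yN] aU by (auto simp: Bad_def)
      finally show ?thesis by (simp only: 1 2 power_Suc mult.assoc)
    qed
    ultimately have "good (insert z P) \<psi>" by (auto simp: good_def)
    then show ?case by blast
  qed
  from this[OF subset_refl] show ?thesis by (auto simp: good_def)
qed

subsection \<open>Sparse unions of random perfect matchings\<close>

text \<open>Double counting: composing with the transposition of \<open>x\<close> and
  \<open>y\<close> lets any \<open>y\<close> outside \<open>T\<close> take over the role of
  \<open>x\<close> without changing the values on \<open>T\<close>. A permutation that maps
  \<open>T\<close> into \<open>B\<close> has only \<open>card B - card T\<close> places of
  \<open>B\<close> left for such \<open>y\<close>. If \<open>B\<close> is smaller than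
  \<open>T\<close>, no permutation qualifies and the truncated difference does no harm.\<close>

lemma card_permutations_into_step:
  assumes "finite M" "insert x T \<subseteq> M" "x \<notin> T" "B \<subseteq> M"
  shows "card {p. p permutes M \<and> p ` insert x T \<subseteq> B} * (card M - card T)
       \<le> card {p. p permutes M \<and> p ` T \<subseteq> B} * (card B - card T)"
proof -
  define F where "F T = {p. p permutes M \<and> p ` T \<subseteq> B}" for T
  have finF: "finite (F S)" for S
    unfolding F_def using finite_permutations[OF assms(1)] by (rule rev_finite_subset) auto
  have T: "T \<subseteq> M" "finite T" and "finite B"
    using assms finite_subset by auto
  define R where "R = Sigma (F T) (\<lambda>q. {y \<in> M - T. q y \<in> B})"
  have "card (F (insert x T) \<times> (M - T)) \<le> card R"
  proof (rule card_inj_on_le)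
    show "inj_on (\<lambda>(p, y). (p \<circ> transpose x y, y)) (F (insert x T) \<times> (M - T))"
    proof (rule inj_onI, clarsimp)
      fix p q y assume "p \<circ> transpose x y = q \<circ> transpose x y"
      then have "p \<circ> transpose x y \<circ> transpose x y = q \<circ> transpose x y \<circ> transpose x y" by simp
      then show "p = q" by (simp add: comp_assoc)
    qed
    show "(\<lambda>(p, y). (p \<circ> transpose x y, y)) ` (F (insert x T) \<times> (M - T)) \<subseteq> R"
    proof clarsimp
      fix p y assume p: "p \<in> F (insert x T)" and y: "y \<in> M" "y \<notin> T"
      have "p \<circ> transpose x y permutes M"
        using p y assms by (intro permutes_compose permutes_swap_id) (auto simp: F_def)
      moreover have "(p \<circ> transpose x y) t = p t" if "t \<in> T" for t
        using that y assms(3) by (auto simp: transpose_def)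
      ultimately show "(p \<circ> transpose x y, y) \<in> R"
        using p y by (auto simp: R_def F_def)
    qed
    show "finite R"
      using finF assms(1) by (auto simp: R_def)
  qed
  also have "card R = (\<Sum>q\<in>F T. card {y \<in> M - T. q y \<in> B})"
    using finF assms(1) by (simp add: R_def)
  also have "\<dots> \<le> (\<Sum>q\<in>F T. card B - card T)"
  proof (rule sum_mono)
    fix q assume q: "q \<in> F T"
    then have inj: "inj q" by (auto simp: F_def permutes_inj)
    have "card {y \<in> M - T. q y \<in> B} \<le> card (B - q ` T)"
      using \<open>finite B\<close>
      by (intro card_inj_on_le[of q] inj_on_subset[OF inj]) (auto dest: injD[OF inj])
    also have "\<dots> = card B - card T"
      using q T card_Diff_subset[of "q ` T" B] card_image[OF inj_on_subset[OF inj subset_UNIV], of T]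
      by (simp add: F_def)
    finally show "card {y \<in> M - T. q y \<in> B} \<le> card B - card T" .
  qed
  finally have "card (F (insert x T)) * card (M - T) \<le> card (F T) * (card B - card T)"
    by (simp only: card_cartesian_product sum_constant of_nat_id)
  then show ?thesis
    unfolding F_def card_Diff_subset[OF T(2,1)] .
qed

text \<open>Division-free form of the bound \<open>(card B / card M) ^ card T\<close> for the
  probability that a uniform permutation maps \<open>T\<close> into \<open>B\<close>. Sampling
  without replacement only lowers the probability, because
  \<open>(s - t) / (m - t) \<le> s / m\<close>.\<close>

lemma card_permutations_into:
  assumes "finite M" "T \<subseteq> M" "B \<subseteq> M"
  shows "card {p. p permutes M \<and> p ` T \<subseteq> B} * card M ^ card T \<le> fact (card M) * card B ^ card T"
  using finite_subset[OF assms(2,1)] assms(2)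
proof (induction T rule: finite_induct)
  case empty
  then show ?case
    using card_permutations[OF refl assms(1)] by simp
next
  case (insert x T)
  define m s t where "m = card M" and "s = card B" and "t = card T"
  define P P' where "P = card {p. p permutes M \<and> p ` T \<subseteq> B}"
    and "P' = card {p. p permutes M \<and> p ` insert x T \<subseteq> B}"
  have IH: "P * m ^ t \<le> fact m * s ^ t"
    using insert by (simp add: P_def m_def s_def t_def)
  have step: "P' * (m - t) \<le> P * (s - t)"
    using card_permutations_into_step[OF assms(1) insert(4,2) assms(3)]
    by (simp add: P_def P'_def m_def s_def t_def)
  have "s \<le> m"
    using card_mono[OF assms(1,3)] by (simp add: m_def s_def)
  have "Suc t \<le> m"
    using card_mono[OF assms(1) insert(4)] insert(1,2) by (simp add: m_def t_def)
  have frac: "(s - t) * m \<le> s * (m - t)"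
    using mult_right_mono[OF \<open>s \<le> m\<close>, of t]
    by (simp add: diff_mult_distrib diff_mult_distrib2 mult.commute diff_le_mono2)
  have "(P' * m ^ Suc t) * (m - t) = P' * (m - t) * m ^ t * m"
    by (simp add: mult_ac)
  also have "\<dots> \<le> P * (s - t) * m ^ t * m"
    by (intro mult_right_mono step) auto
  also have "\<dots> = P * m ^ t * ((s - t) * m)"
    by (simp add: mult_ac)
  also have "\<dots> \<le> fact m * s ^ t * (s * (m - t))"
    by (intro mult_mono IH frac) auto
  also have "\<dots> = (fact m * s ^ Suc t) * (m - t)"
    by (simp add: mult_ac)
  finally have "P' * m ^ Suc t \<le> fact m * s ^ Suc t"
    using \<open>Suc t \<le> m\<close> by simp
  then show ?case
    using insert(1,2) by (simp add: P'_def m_def s_def t_def)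
qed

text \<open>The permutations of a tuple are independent, so the bounds for the slices of
  \<open>T\<close> multiply. Here \<open>T\<close> is a set of edge indices
  \<open>(i, x)\<close>.\<close>

lemma card_permutation_tuples_into:
  assumes "finite M" "T \<subseteq> {..<d} \<times> M" "B \<subseteq> M"
  shows "card {p \<in> Pi\<^sub>E {..<d} (\<lambda>_. {q. q permutes M}). \<forall>(i, x)\<in>T. p i x \<in> B} * card M ^ card T
       \<le> fact (card M) ^ d * card B ^ card T"
proof -
  define S where "S i = {x. (i, x) \<in> T}" for i
  have S: "S i \<subseteq> M" "finite (S i)" for i
    using assms(2) finite_subset[OF _ assms(1), of "S i"] by (auto simp: S_def)
  have T: "T = Sigma {..<d} S"
    using assms(2) by (auto simp: S_def)
  have cT: "card T = (\<Sum>i<d. card (S i))"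
    unfolding T using S by simp
  have "{p \<in> Pi\<^sub>E {..<d} (\<lambda>_. {q. q permutes M}). \<forall>(i, x)\<in>T. p i x \<in> B}
      = Pi\<^sub>E {..<d} (\<lambda>i. {q. q permutes M \<and> q ` S i \<subseteq> B})"
    unfolding T by (auto simp: PiE_iff image_subset_iff) (metis extensional_arb lessThan_iff)+
  then have "card {p \<in> Pi\<^sub>E {..<d} (\<lambda>_. {q. q permutes M}). \<forall>(i, x)\<in>T. p i x \<in> B} * card M ^ card T
      = (\<Prod>i<d. card {q. q permutes M \<and> q ` S i \<subseteq> B} * card M ^ card (S i))"
    by (simp add: card_PiE cT power_sum prod.distrib)
  also have "\<dots> \<le> (\<Prod>i<d. fact (card M) * card B ^ card (S i))"
    using card_permutations_into[OF assms(1) S(1) assms(3)] by (intro prod_mono) auto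
  also have "\<dots> = fact (card M) ^ d * card B ^ card T"
    by (simp add: prod.distrib cT power_sum)
  finally show ?thesis .
qed

text \<open>\<open>s ^ s / fact s\<close> is a single term of the exponential series at
  \<open>s\<close>, and e is less than 4.\<close>

lemma power_self_le_fact: "real s ^ s \<le> 4 ^ s * fact s"
proof -
  have "real s ^ s / fact s \<le> (\<Sum>k\<in>{s}. inverse (fact k) * real s ^ k)"
    by (simp add: field_simps)
  also have "\<dots> \<le> (\<Sum>k. inverse (fact k) * real s ^ k)"
    by (intro sum_le_suminf summable_exp) auto
  also have "\<dots> = exp (real s)"
    by (simp add: exp_def divide_inverse mult.commute)
  also have "\<dots> = exp 1 ^ s"
    by (simp flip: exp_of_nat_mult)
  also have "\<dots> \<le> 4 ^ s"
    using exp_le by (intro power_mono) auto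
  finally show ?thesis
    by (simp add: field_simps)
qed

lemma binomial_le_ratio_power: "s > 0 \<Longrightarrow> real (m choose s) \<le> (4 * m / s) ^ s"
proof -
  assume "s > 0"
  have "real (m choose s) * real s ^ s \<le> real (m choose s) * (4 ^ s * fact s)"
    by (intro mult_left_mono power_self_le_fact) auto
  also have "\<dots> = 4 ^ s * real ((m choose s) * fact s)"
    by simp
  also have "\<dots> \<le> 4 ^ s * real (m ^ s)"
    using binomial_fact_pow[of m s] by (intro mult_left_mono) (simp_all only: of_nat_le_iff, simp)
  finally show ?thesis
    using \<open>s > 0\<close> by (simp add: field_simps)
qed

text \<open>The constants are chosen such that \<open>4\<^sup>2 * 2 ^ 40 * (2 ^ (-16)) ^ (5 - 2) = 1/16\<close>, which makes
  the union bound over all pairs of sets of size \<open>s\<close> and all sets of \<open>5 s\<close> edges summable.\<close>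

lemma union_bound_term:
  assumes "0 < s" "65536 * s \<le> m"
  shows "real (m choose s) ^ 2 * 2 ^ (40 * s) * (s / m) ^ (5 * s) \<le> (1/16) ^ s"
proof -
  have m: "m > 0" using assms by linarith
  have sq: "(x ^ s) ^ 2 = (x ^ 2) ^ s" for x :: real
    by (simp flip: power_mult add: mult.commute)
  have "real (m choose s) ^ 2 * 2 ^ (40 * s) * (s / m) ^ (5 * s)
      \<le> ((4 * m / s) ^ s) ^ 2 * 2 ^ (40 * s) * (s / m) ^ (5 * s)"
    using binomial_le_ratio_power[OF assms(1), of m] by (intro mult_right_mono power_mono) auto
  also have "\<dots> = ((4 * m / s) ^ 2 * 2 ^ 40 * (s / m) ^ 5) ^ s"
    by (simp only: power_mult power_mult_distrib sq)
  also have "(4 * m / s) ^ 2 * 2 ^ 40 * (s / m) ^ 5 = 2 ^ 44 * (s / m) ^ 3"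
    using assms(1) m by (simp add: field_simps eval_nat_numeral)
  also have "(2 ^ 44 * (real s / m) ^ 3) ^ s \<le> (2 ^ 44 * (1 / 65536) ^ 3) ^ s"
    using assms m by (intro power_mono mult_left_mono) (auto simp: field_simps)
  finally show ?thesis by (simp add: field_simps)
qed

text \<open>First moment method in counting form: the bad events, one for each choice of
  \<open>A\<close>, \<open>B\<close> and a set of edge indices forced into \<open>B\<close>, do not
  exhaust all tuples. Small sets thus span few edges per vertex, although every vertex has degree 40
  counted with multiplicity.\<close>

lemma ex_sparse_permutations:
  fixes m :: nat
  shows "\<exists>p :: nat \<Rightarrow> nat \<Rightarrow> nat. (\<forall>i<40. p i permutes {..<m}) \<and>
    (\<forall>A\<subseteq>{..<m}. \<forall>B\<subseteq>{..<m}. 65536 * (card A + card B) \<le> m \<longrightarrow>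
       card {(i, x). i < 40 \<and> x \<in> A \<and> p i x \<in> B} \<le> 5 * (card A + card B))"
proof -
  define M where "M = {..<m}"
  define \<Omega> where "\<Omega> = Pi\<^sub>E {..<40::nat} (\<lambda>_. {q. q permutes M})"
  define G where "G T B = {p \<in> \<Omega>. \<forall>(i, x)\<in>T. p i x \<in> B}" for T B
  define I where "I s = {A. A \<subseteq> M \<and> card A = s}" for s
  define Ts where "Ts s A = {T. T \<subseteq> {..<40::nat} \<times> A \<and> 5 * s \<le> card T}" for s and A :: "nat set"
  define Ss where "Ss = {s. 0 < s \<and> 65536 * s \<le> m}"
  define Bad where "Bad = (\<Union>s\<in>Ss. \<Union>A\<in>I s. \<Union>B\<in>I s. \<Union>T\<in>Ts s A. G T B)"
  have M: "finite M" "card M = m" by (auto simp: M_def)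
  have fin\<Omega>: "finite \<Omega>"
    using finite_permutations[OF M(1)] by (auto simp: \<Omega>_def intro: finite_PiE)
  have card\<Omega>: "card \<Omega> = fact m ^ 40"
    using card_permutations[OF M(2,1)] by (simp add: \<Omega>_def card_PiE)
  have finI: "finite (I s)" and cardI: "card (I s) = m choose s" for s
    using n_subsets[OF M(1), of s] M by (simp_all add: I_def)
  have finTs: "finite (Ts s A)" and cardTs: "card (Ts s A) \<le> 2 ^ (40 * s)" if "A \<in> I s" for s A
  proof -
    have A: "finite A" "card A = s"
      using that M(1) finite_subset by (auto simp: I_def)
    show "finite (Ts s A)"
      using A by (auto simp: Ts_def intro: finite_subset[of _ "Pow ({..<40} \<times> A)"])
    have "card (Ts s A) \<le> card (Pow ({..<40::nat} \<times> A))"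
      using A by (intro card_mono) (auto simp: Ts_def)
    then show "card (Ts s A) \<le> 2 ^ (40 * s)"
      using A by (simp add: card_Pow card_cartesian_product)
  qed
  have finSs: "finite Ss"
    by (rule finite_subset[of _ "{..m}"]) (auto simp: Ss_def)
  have G: "real (card (G T B)) \<le> fact m ^ 40 * (s / m) ^ (5 * s)"
    if "s \<in> Ss" "A \<in> I s" "B \<in> I s" "T \<in> Ts s A" for s A B T
  proof -
    have m: "m > 0" and s: "s \<le> m" using that(1) by (auto simp: Ss_def)
    have T: "T \<subseteq> {..<40} \<times> M"
      using that by (auto simp: Ts_def I_def)
    have "card (G T B) * m ^ card T \<le> fact m ^ 40 * s ^ card T"
      using card_permutation_tuples_into[OF M(1) T, of B] that(3) M
      by (simp add: G_def \<Omega>_def I_def)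
    then have "real (card (G T B)) * real m ^ card T \<le> fact m ^ 40 * real s ^ card T"
      by (metis (mono_tags, lifting) of_nat_fact of_nat_le_iff of_nat_mult of_nat_power)
    then have "real (card (G T B)) \<le> fact m ^ 40 * (s / m) ^ card T"
      using m by (simp add: field_simps power_divide)
    also have "\<dots> \<le> fact m ^ 40 * (s / m) ^ (5 * s)"
      using that(4) s m by (intro mult_left_mono power_decreasing) (auto simp: Ts_def)
    finally show ?thesis .
  qed
  have "real (card Bad) \<le> (\<Sum>s\<in>Ss. \<Sum>A\<in>I s. \<Sum>B\<in>I s. \<Sum>T\<in>Ts s A. real (card (G T B)))"
  proof -
    have "card Bad \<le> (\<Sum>s\<in>Ss. card (\<Union>A\<in>I s. \<Union>B\<in>I s. \<Union>T\<in>Ts s A. G T B))"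
      unfolding Bad_def by (intro card_UN_le finSs)
    also have "\<dots> \<le> (\<Sum>s\<in>Ss. \<Sum>A\<in>I s. card (\<Union>B\<in>I s. \<Union>T\<in>Ts s A. G T B))"
      by (intro sum_mono card_UN_le finI)
    also have "\<dots> \<le> (\<Sum>s\<in>Ss. \<Sum>A\<in>I s. \<Sum>B\<in>I s. card (\<Union>T\<in>Ts s A. G T B))"
      by (intro sum_mono card_UN_le finI)
    also have "\<dots> \<le> (\<Sum>s\<in>Ss. \<Sum>A\<in>I s. \<Sum>B\<in>I s. \<Sum>T\<in>Ts s A. card (G T B))"
      by (intro sum_mono card_UN_le finTs)
    finally show ?thesis
      by (simp flip: of_nat_sum)
  qed
  also have "\<dots> \<le> (\<Sum>s\<in>Ss. \<Sum>A\<in>I s. \<Sum>B\<in>I s. \<Sum>T\<in>Ts s A. fact m ^ 40 * (s / m) ^ (5 * s))"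
    by (intro sum_mono G)
  also have "\<dots> \<le> (\<Sum>s\<in>Ss. \<Sum>A\<in>I s. \<Sum>B\<in>I s. 2 ^ (40 * s) * (fact m ^ 40 * (s / m) ^ (5 * s)))"
  proof (intro sum_mono)
    fix s A assume "A \<in> I s"
    then have "real (card (Ts s A)) \<le> 2 ^ (40 * s)"
      using cardTs by (metis of_nat_le_iff of_nat_numeral of_nat_power)
    then show "(\<Sum>T\<in>Ts s A. fact m ^ 40 * (real s / m) ^ (5 * s)) \<le> 2 ^ (40 * s) * (fact m ^ 40 * (s / m) ^ (5 * s))"
      by (simp add: mult_right_mono)
  qed
  also have "\<dots> = (\<Sum>s\<in>Ss. fact m ^ 40 * (real (m choose s) ^ 2 * 2 ^ (40 * s) * (s / m) ^ (5 * s)))"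
    by (simp add: cardI power2_eq_square mult_ac)
  also have "\<dots> \<le> (\<Sum>s\<in>Ss. fact m ^ 40 * (1/16) ^ s)"
    by (intro sum_mono mult_left_mono union_bound_term) (auto simp: Ss_def)
  also have "\<dots> = fact m ^ 40 * (\<Sum>s\<in>Ss. (1/16) ^ s)"
    by (simp add: sum_distrib_left)
  also have "\<dots> < fact m ^ 40 * 1"
  proof (intro mult_strict_left_mono)
    have "(\<Sum>s\<in>Ss. (1/16::real) ^ s) \<le> (\<Sum>s\<in>{1..m}. (1/16) ^ s)"
      by (intro sum_mono2) (auto simp: Ss_def)
    also have "\<dots> \<le> 1 - (1/16) ^ m"
    proof (induction m)
      case (Suc m)
      have "(0::real) < (1/16) ^ m" by simp
      from Suc show ?case by simp (use \<open>0 < (1/16) ^ m\<close> in linarith)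
    qed simp
    also have "\<dots> < 1" by simp
    finally show "(\<Sum>s\<in>Ss. (1/16::real) ^ s) < 1" .
  qed auto
  finally have "real (card Bad) < real (card \<Omega>)"
    by (simp add: card\<Omega>)
  moreover have "finite Bad"
    using fin\<Omega> by (rule rev_finite_subset) (auto simp: Bad_def G_def)
  ultimately have "\<not> \<Omega> \<subseteq> Bad"
    using card_mono[of Bad \<Omega>] by auto
  then obtain p where p: "p \<in> \<Omega>" "p \<notin> Bad" by blast
  have "card {(i, x). i < 40 \<and> x \<in> A \<and> p i x \<in> B} \<le> 5 * (card A + card B)"
    if AB: "A \<subseteq> M" "B \<subseteq> M" "65536 * (card A + card B) \<le> m" for A B
  proof (rule ccontr)
    define T where "T = {(i, x). i < 40 \<and> x \<in> A \<and> p i x \<in> B}"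
    \<comment> \<open>Padding both sets to the larger of the two sizes leaves one parameter in the
      union bound. More than \<open>5 * (card A + card B)\<close> edges are in particular at least
      \<open>5 * s\<close>.\<close>
    define s where "s = max (card A) (card B)"
    assume "\<not> ?thesis"
    then have T: "card T > 5 * (card A + card B)" by (simp add: T_def)
    have fin: "finite A" "finite B" using AB M(1) finite_subset by blast+
    have "T \<subseteq> {..<40} \<times> A" by (auto simp: T_def)
    have "s \<in> Ss"
    proof -
      have "s \<noteq> 0"
      proof
        assume "s = 0"
        then have "A = {}" using fin by (simp add: s_def)
        then show False using T by (simp add: T_def)
      qed
      then show ?thesis using AB(3) by (auto simp: Ss_def s_def)
    qed
    then have "s \<le> card M" using M(2) by (auto simp: Ss_def)
    obtain A' where A': "A \<subseteq> A'" "A' \<subseteq> M" "card A' = s"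
      using exists_subset_between[of A s M] AB \<open>s \<le> card M\<close> M(1) by (auto simp: s_def)
    obtain B' where B': "B \<subseteq> B'" "B' \<subseteq> M" "card B' = s"
      using exists_subset_between[of B s M] AB \<open>s \<le> card M\<close> M(1) by (auto simp: s_def)
    have "T \<in> Ts s A'"
      using T A' \<open>T \<subseteq> _\<close> by (auto simp: Ts_def s_def)
    moreover have "p \<in> G T B'"
      using p(1) B' by (auto simp: G_def T_def)
    ultimately have "p \<in> Bad"
      using A' B' \<open>s \<in> Ss\<close> unfolding Bad_def I_def by blast
    with p(2) show False by blast
  qed
  moreover have "p i permutes M" if "i < 40" for i
    using p(1) that by (auto simp: \<Omega>_def)
  ultimately show ?thesis
    unfolding M_def by blast
qed

subsection \<open>Walks in large monochromatic components\<close>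

lemma rtranclp_leaves_set:
  assumes "r\<^sup>*\<^sup>* v w" "v \<in> S" "w \<notin> S"
  shows "\<exists>a\<in>S. \<exists>b. b \<notin> S \<and> r a b"
  using assms by (induction rule: rtranclp_induct) auto

text \<open>The walk is a traversal of a spanning tree: a new vertex is visited by a detour from one of
  the occurrences of its parent, which adds one more occurrence of the parent.\<close>

lemma traversal_walk:
  fixes adj :: "'h \<Rightarrow> 'h \<Rightarrow> bool"
  assumes sym: "\<And>u w. adj u w \<Longrightarrow> adj w u"
    and fin: "finite {u. adj\<^sup>*\<^sup>* v u}"
    and deg: "\<And>u. finite {w. adj u w} \<and> card {w. adj u w} \<le> D"
  shows "\<exists>ws. successively adj ws \<and> set ws = {u. adj\<^sup>*\<^sup>* v u} \<and> (\<forall>u. count_list ws u \<le> Suc D)"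
proof -
  define R where "R = {u. adj\<^sup>*\<^sup>* v u}"
  \<comment> \<open>Repeated visits are charged to neighbours: every detour from \<open>u\<close>
    brings one new neighbour of \<open>u\<close> into the walk. The degree bound then gives
    \<open>Suc D\<close>, where the one extra visit is the first.\<close>
  have "\<exists>ws. successively adj ws \<and> set ws \<subseteq> R \<and> v \<in> set ws \<and> card (set ws) = Suc j \<and>
      (\<forall>u. count_list ws u \<le> Suc (card {w \<in> set ws. adj u w}))" if "Suc j \<le> card R" for j
    using that
  proof (induction j)
    case 0
    show ?case by (rule exI[of _ "[v]"]) (auto simp: R_def)
  next
    case (Suc j)
    then obtain ws where ws: "successively adj ws" "set ws \<subseteq> R" "v \<in> set ws" "card (set ws) = Suc j"
      and count: "\<And>u. count_list ws u \<le> Suc (card {w \<in> set ws. adj u w})"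
      by auto
    have "set ws \<noteq> R" using ws(4) Suc(2) by auto
    then obtain w where "w \<in> R" "w \<notin> set ws" using ws(2) by blast
    then obtain a b where ab: "a \<in> set ws" "b \<notin> set ws" "adj a b"
      using rtranclp_leaves_set[of adj v w "set ws"] ws(3) by (auto simp: R_def)
    then have b: "b \<in> R"
      using ws(2) by (auto simp: R_def intro: rtranclp.rtrancl_into_rtrancl)
    obtain p q where pq: "ws = p @ a # q"
      using ab(1) by (meson split_list)
    define ws' where "ws' = p @ a # b # a # q"
    have set': "set ws' = insert b (set ws)"
      by (auto simp: ws'_def pq)
    have "successively adj ws'"
      using ws(1) ab(3) sym unfolding ws'_def pq by (auto simp: successively_append_iff successively_Cons)
    moreover have "count_list ws' u \<le> Suc (card {w \<in> set ws'. adj u w})" for u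
    proof -
      have sub: "{w \<in> set ws. adj u w} \<subseteq> {w \<in> set ws'. adj u w}"
        by (auto simp: set')
      then have le: "card {w \<in> set ws. adj u w} \<le> card {w \<in> set ws'. adj u w}"
        by (intro card_mono) auto
      have "{w \<in> set ws'. adj a w} = insert b {w \<in> set ws. adj a w}"
        using ab by (auto simp: set')
      then have a: "card {w \<in> set ws'. adj a w} = Suc (card {w \<in> set ws. adj a w})"
        using ab by simp
      have "count_list ws' u = count_list ws u + (if u = a then 1 else 0) + (if u = b then 1 else 0)"
        by (simp add: ws'_def pq)
      moreover have "count_list ws b = 0"
        using ab(2) by (simp add: count_list_0_iff)
      moreover have "a \<noteq> b" using ab by blast
      ultimately show ?thesis
        using count[of u] le a by (auto split: if_splits)
    qed
    moreover have "card (set ws') = Suc (Suc j)"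
      using ws(4) ab(2) by (simp add: set')
    moreover have "set ws' \<subseteq> R" "v \<in> set ws'" using ws b by (auto simp: set')
    ultimately show ?case by blast
  qed
  moreover have "0 < card R"
    using fin by (auto simp: R_def card_gt_0_iff)
  ultimately obtain ws where ws: "successively adj ws" "set ws \<subseteq> R" "card (set ws) = card R"
    and count: "\<And>u. count_list ws u \<le> Suc (card {w \<in> set ws. adj u w})"
    by (metis Suc_pred le_refl)
  have "set ws = R"
    using ws fin by (simp add: R_def card_subset_eq)
  moreover have "card {w \<in> set ws. adj u w} \<le> D" for u
    using card_mono[of "{w. adj u w}" "{w \<in> set ws. adj u w}"] deg[of u] by fastforce
  ultimately show ?thesis
    using ws(1) count unfolding R_def by (meson Suc_le_mono le_trans)
qed

text \<open>The bipartite graph on two copies of \<open>{..<m}\<close> that is the union of \<open>d\<close> perfect matchings, the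
  \<open>i\<close>-th of which joins \<open>Inl x\<close> to \<open>Inr (p i x)\<close>, restricted to those edges \<open>(i, x)\<close> that
  satisfy \<open>P\<close> (later: the edges of one colour).\<close>

definition hadj :: "nat \<Rightarrow> nat \<Rightarrow> (nat \<Rightarrow> nat \<Rightarrow> nat) \<Rightarrow> (nat \<Rightarrow> nat \<Rightarrow> bool) \<Rightarrow> nat + nat \<Rightarrow> nat + nat \<Rightarrow> bool" where
  "hadj d m p P u v \<longleftrightarrow> (\<exists>i<d. \<exists>x<m. P i x \<and>
     (u = Inl x \<and> v = Inr (p i x) \<or> u = Inr (p i x) \<and> v = Inl x))"

lemma hadj_sym: "hadj d m p P u v \<Longrightarrow> hadj d m p P v u"
  by (auto simp: hadj_def)

lemma hadj_degree:
  assumes "\<And>i. i < d \<Longrightarrow> p i permutes {..<m}"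
  shows "finite {v. hadj d m p P u v} \<and> card {v. hadj d m p P u v} \<le> d"
proof -
  define f where "f i = (case u of Inl x \<Rightarrow> Inr (p i x) | Inr y \<Rightarrow> Inl (inv (p i) y))" for i
  have "v \<in> f ` {..<d}" if "hadj d m p P u v" for v
  proof -
    from that obtain i x where i: "i < d"
      and "u = Inl x \<and> v = Inr (p i x) \<or> u = Inr (p i x) \<and> v = Inl x"
      by (auto simp: hadj_def)
    then have "v = f i"
      using permutes_inverses(2)[OF assms[OF i]] by (auto simp: f_def)
    with i show ?thesis by blast
  qed
  then have "{v. hadj d m p P u v} \<subseteq> f ` {..<d}" by blast
  then show ?thesis
    using surj_card_le[of "{..<d}" _ f] finite_subset by fastforce
qed

lemma card_Plus_parts:
  fixes C :: "('a + 'b) set"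
  assumes "finite C"
  shows "card {x. Inl x \<in> C} + card {y. Inr y \<in> C} = card C"
proof -
  have C: "C = {x. Inl x \<in> C} <+> {y. Inr y \<in> C}"
    by (auto simp: Plus_def image_iff) (metis sum.exhaust)
  have "finite {x. Inl x \<in> C}" "finite {y. Inr y \<in> C}"
    using finite_vimageI[OF assms, of Inl] finite_vimageI[OF assms, of Inr] by (auto simp: vimage_def)
  then show ?thesis
    by (subst (3) C) (simp add: card_Plus)
qed

text \<open>Every edge lies inside one component, a small component \<open>C\<close> spans at most
  \<open>5 * card C\<close> edges by sparsity, and the components partition the \<open>2 * m\<close>
  vertices. Edges are counted as indices \<open>(i, x)\<close>, so those shared by several matchings
  count repeatedly.\<close>

lemma card_edges_of_small_components:
  fixes m :: nat and P :: "nat \<Rightarrow> nat \<Rightarrow> bool"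
  assumes p: "\<And>i. i < 40 \<Longrightarrow> p i permutes {..<m}"
    and sparse: "\<And>A B. A \<subseteq> {..<m} \<Longrightarrow> B \<subseteq> {..<m} \<Longrightarrow> 65536 * (card A + card B) \<le> m \<Longrightarrow>
       card {(i, x). i < 40 \<and> x \<in> A \<and> p i x \<in> B} \<le> 5 * (card A + card B)"
    and small: "\<And>v. v \<in> {..<m} <+> {..<m} \<Longrightarrow> 65536 * card {u. (hadj 40 m p P)\<^sup>*\<^sup>* v u} \<le> m"
  shows "card {(i, x). i < 40 \<and> x < m \<and> P i x} \<le> 10 * m"
proof -
  define V where "V = {..<m} <+> {..<m}"
  define r where "r = {(u, v). u \<in> V \<and> v \<in> V \<and> (hadj 40 m p P)\<^sup>*\<^sup>* u v}"
  define E where "E = {(i, x). i < 40 \<and> x < m \<and> P i x}"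
  define EC where "EC C = {(i, x). (i, x) \<in> E \<and> Inl x \<in> C}" for C :: "(nat + nat) set"
  have finV: "finite V" and cardV: "card V = 2 * m"
    by (auto simp: V_def card_Plus)
  have hadjV: "v \<in> V" if "hadj 40 m p P u v" for u v
    using that permutes_in_image[OF p] by (auto simp: hadj_def V_def)
  have reachV: "u \<in> V" if "(hadj 40 m p P)\<^sup>*\<^sup>* v u" "v \<in> V" for u v
    using that by (induction rule: rtranclp_induct) (auto intro: hadjV)
  have "sym r"
    using sympD[OF symp_rtranclp[OF sympI[OF hadj_sym]]] by (auto simp: r_def intro!: symI)
  moreover have "trans r"
    by (auto simp: r_def intro!: transI)
  moreover have "refl_on V r" "r \<subseteq> V \<times> V"
    by (auto simp: r_def refl_on_def)
  ultimately have equiv: "equiv V r"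
    by (auto simp: equiv_def)
  have finE: "finite E"
    by (rule finite_subset[of _ "{..<40} \<times> {..<m}"]) (auto simp: E_def)
  have finQ: "finite (V // r)"
    using finV \<open>r \<subseteq> V \<times> V\<close> by (rule finite_quotient)
  have "E \<subseteq> (\<Union>C\<in>V // r. EC C)"
  proof
    fix e assume "e \<in> E"
    then obtain i x where e: "e = (i, x)" "x < m" by (auto simp: E_def)
    then have "Inl x \<in> V" by (auto simp: V_def)
    then have "Inl x \<in> \<Union>(V // r)" using Union_quotient[OF equiv] by simp
    then show "e \<in> (\<Union>C\<in>V // r. EC C)" using e \<open>e \<in> E\<close> by (auto simp: EC_def)
  qed
  then have "card E \<le> card (\<Union>C\<in>V // r. EC C)"
    using finE by (intro card_mono finite_subset[of "\<Union>C\<in>V // r. EC C" E]) (auto simp: EC_def)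
  also have "\<dots> \<le> (\<Sum>C\<in>V // r. card (EC C))"
    by (rule card_UN_le[OF finQ])
  also have "\<dots> \<le> (\<Sum>C\<in>V // r. 5 * card C)"
  proof (rule sum_mono)
    fix C assume C: "C \<in> V // r"
    define A B where "A = {x. Inl x \<in> C}" and "B = {y. Inr y \<in> C}"
    from C obtain v where v: "v \<in> V" "C = r `` {v}" by (auto elim: quotientE)
    then have C_eq: "C = {u. (hadj 40 m p P)\<^sup>*\<^sup>* v u}"
      using reachV by (auto simp: r_def)
    have "C \<subseteq> V" using v by (auto simp: r_def)
    then have "finite C" using finV finite_subset by blast
    have cC: "card A + card B = card C"
      unfolding A_def B_def by (rule card_Plus_parts[OF \<open>finite C\<close>])
    have AB: "A \<subseteq> {..<m}" "B \<subseteq> {..<m}"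
      using \<open>C \<subseteq> V\<close> by (auto simp: A_def B_def V_def)
    have "EC C \<subseteq> {(i, x). i < 40 \<and> x \<in> A \<and> p i x \<in> B}"
    proof clarsimp
      fix i x assume "(i, x) \<in> EC C"
      then have ix: "i < 40" "x < m" "P i x" "Inl x \<in> C" by (auto simp: EC_def E_def)
      then have "hadj 40 m p P (Inl x) (Inr (p i x))" by (auto simp: hadj_def)
      with ix have "Inr (p i x) \<in> C"
        unfolding C_eq by (auto intro: rtranclp.rtrancl_into_rtrancl)
      with ix show "i < 40 \<and> x \<in> A \<and> p i x \<in> B" by (auto simp: A_def B_def)
    qed
    moreover have "finite {(i, x). i < 40 \<and> x \<in> A \<and> p i x \<in> B}"
      by (rule finite_subset[of _ "{..<40} \<times> {..<m}"]) (use AB in auto)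
    ultimately have "card (EC C) \<le> card {(i, x). i < 40 \<and> x \<in> A \<and> p i x \<in> B}"
      by (intro card_mono)
    also have "\<dots> \<le> 5 * (card A + card B)"
      using sparse[OF AB] small[of v] v(1) C_eq cC by (simp add: V_def)
    finally show "card (EC C) \<le> 5 * card C" by (simp add: cC)
  qed
  also have "\<dots> = 5 * card (\<Union>(V // r))"
  proof -
    have "pairwise disjnt (V // r)"
      using quotient_disj[OF equiv] by (auto simp: pairwise_def disjnt_def)
    moreover have "finite C" if "C \<in> V // r" for C
      using that Union_quotient[OF equiv] finV by (metis Union_upper finite_subset)
    ultimately show ?thesis
      by (simp add: card_Union_disjoint sum_distrib_left)
  qed
  also have "\<dots> = 10 * m"
    using Union_quotient[OF equiv] by (simp add: cardV)
  finally show ?thesis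
    by (simp add: E_def)
qed

text \<open>With small components only, the two colours would account for at most
  \<open>20 * m\<close> of the \<open>40 * m\<close> edge indices. This is what forty matchings are
  for.\<close>

lemma ex_large_monochromatic_component:
  fixes m :: nat and c :: "nat \<Rightarrow> nat \<Rightarrow> bool"
  assumes p: "\<And>i. i < 40 \<Longrightarrow> p i permutes {..<m}"
    and sparse: "\<And>A B. A \<subseteq> {..<m} \<Longrightarrow> B \<subseteq> {..<m} \<Longrightarrow> 65536 * (card A + card B) \<le> m \<Longrightarrow>
       card {(i, x). i < 40 \<and> x \<in> A \<and> p i x \<in> B} \<le> 5 * (card A + card B)"
    and "m > 0"
  shows "\<exists>k. \<exists>v \<in> {..<m} <+> {..<m}. m < 65536 * card {u. (hadj 40 m p (\<lambda>i x. c i x = k))\<^sup>*\<^sup>* v u}"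
proof (rule ccontr)
  assume "\<not> ?thesis"
  then have *: "card {(i, x). i < 40 \<and> x < m \<and> c i x = k} \<le> 10 * m" for k
    by (intro card_edges_of_small_components[OF p sparse]) (auto simp: not_less)
  have "{..<40::nat} \<times> {..<m} = {(i, x). i < 40 \<and> x < m \<and> c i x = True} \<union> {(i, x). i < 40 \<and> x < m \<and> c i x = False}"
    by auto
  then have "card ({..<40::nat} \<times> {..<m}) \<le> 10 * m + 10 * m"
    using *[of True] *[of False] by (metis (no_types, lifting) add_mono card_Un_le le_trans)
  then show False
    using \<open>m > 0\<close> by (simp add: card_cartesian_product)
qed

subsection \<open>The blow-up arrows the grid\<close>

text \<open>Lets the blow-up keep its structured vertices: the host is transported along
  \<open>to_nat\<close> and colourings are pulled back.\<close>

lemma size_ramsey_le_countable: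
  fixes G :: "'b :: countable graph"
  assumes "finite_graph G" "arrows G F"
  shows "size_ramsey F \<le> card (edges G)"
proof -
  define f :: "'b \<Rightarrow> nat" where "f = to_nat"
  have inj: "inj f" by (simp add: f_def)
  define G' where "G' = (f ` verts G, (`) f ` edges G)"
  have fin: "finite (edges G)"
    using assms(1) by (auto simp: finite_graph_def intro: finite_subset finite_imp_finite_nsets)
  have "finite_graph G'"
    using assms(1) card_image[OF inj_on_subset[OF inj subset_UNIV]]
    by (auto simp: finite_graph_def G'_def nsets_def)
  moreover have "arrows G' F"
    unfolding arrows_def
  proof
    fix c :: "nat set \<Rightarrow> bool"
    obtain g k where g: "is_copy g F G" "\<forall>e\<in>edges F. c (f ` g ` e) = k"
      using assms(2)[unfolded arrows_def, THEN spec, of "\<lambda>e. c (f ` e)"] by blast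
    have "is_copy (f \<circ> g) F G'"
      unfolding is_copy_def
    proof (intro conjI ballI)
      show "inj_on (f \<circ> g) (verts F)"
        using g(1) inj by (auto simp: is_copy_def intro: comp_inj_on inj_on_subset)
      show "(f \<circ> g) ` verts F \<subseteq> verts G'"
        using g(1) by (auto simp: is_copy_def G'_def)
      show "(f \<circ> g) ` e \<in> edges G'" if "e \<in> edges F" for e
        using g(1) that unfolding image_comp[symmetric] by (auto simp: is_copy_def G'_def)
    qed
    moreover have "\<forall>e\<in>edges F. c ((f \<circ> g) ` e) = k"
      using g(2) by (simp add: image_comp)
    ultimately show "\<exists>f k. is_copy f F G' \<and> (\<forall>e\<in>edges F. c (f ` e) = k)" by blast
  qed
  ultimately have "size_ramsey F \<le> card (edges G')" by (rule size_ramsey_le)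
  also have "\<dots> \<le> card (edges G)"
    using fin by (simp add: G'_def card_image_le)
  finally show ?thesis .
qed

lemma dense_cong:
  assumes "\<And>x y. x \<in> A \<Longrightarrow> y \<in> B \<Longrightarrow> E x y = E' x y"
  shows "dense \<rho> \<delta> E A B = dense \<rho> \<delta> E' A B"
proof -
  have "pairs E X Y = pairs E' X Y" if "X \<subseteq> A" "Y \<subseteq> B" for X Y
    using assms that by (auto simp: pairs_def)
  then show ?thesis by (simp add: dense_def)
qed

text \<open>Adjacency of the unbounded grid in successor form, from which it is visible that
  \<open>i + j\<close> changes by exactly one.\<close>

definition grid_adj :: "nat \<times> nat \<Rightarrow> nat \<times> nat \<Rightarrow> bool" where
  "grid_adj u v \<longleftrightarrow> fst u = fst v \<and> (snd v = Suc (snd u) \<or> snd u = Suc (snd v)) \<or>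
     snd u = snd v \<and> (fst v = Suc (fst u) \<or> fst u = Suc (fst v))"

lemma edges_grid_graphE:
  assumes "e \<in> edges (grid_graph s t)"
  obtains u v where "e = {u, v}" "u \<in> {1..s} \<times> {1..t}" "v \<in> {1..s} \<times> {1..t}" "grid_adj u v"
proof -
  have adj: "grid_adj u v" if "fst u = fst v \<and> \<bar>int (snd u) - int (snd v)\<bar> = 1 \<or>
      snd u = snd v \<and> \<bar>int (fst u) - int (fst v)\<bar> = 1" for u v
    using that unfolding grid_adj_def by linarith
  from assms obtain u v where "e = {u, v}" "u \<in> {1..s} \<times> {1..t}" "v \<in> {1..s} \<times> {1..t}"
    "fst u = fst v \<and> \<bar>int (snd u) - int (snd v)\<bar> = 1 \<or>
     snd u = snd v \<and> \<bar>int (fst u) - int (fst v)\<bar> = 1"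
    unfolding grid_graph_def by auto
  then show thesis using adj by (intro that)
qed

lemma grid_adj_degree: "card {v \<in> W. grid_adj u v} \<le> 4"
proof -
  obtain i j where u: "u = (i, j)" by fastforce
  have "{v \<in> W. grid_adj u v} \<subseteq> set [(i, Suc j), (i, j - 1), (Suc i, j), (i - 1, j)]"
    by (auto simp: grid_adj_def u)
  then have "card {v \<in> W. grid_adj u v} \<le> card (set [(i, Suc j), (i, j - 1), (Suc i, j), (i - 1, j)])"
    by (intro card_mono) auto
  also have "\<dots> \<le> 4"
    using card_length[of "[(i, Suc j), (i, j - 1), (Suc i, j), (i - 1, j)]"] by simp
  finally show ?thesis .
qed

text \<open>The fibre is a union of antidiagonals, one for each occurrence of \<open>w\<close>, and
  on an antidiagonal \<open>i\<close> determines \<open>j\<close>. The length condition makes every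
  index up to \<open>2 * n\<close> valid.\<close>

lemma card_grid_fibre:
  fixes ws :: "'h list"
  assumes "2 * n < length ws"
  shows "card {z \<in> {1..n} \<times> {1..n}. ws ! (fst z + snd z) = w} \<le> count_list ws w * n"
proof -
  define L where "L = {l. l < length ws \<and> w = ws ! l}"
  have L: "finite L" "card L = count_list ws w"
    by (simp_all add: L_def count_list_eq_length_filter length_filter_conv_card)
  have "{z \<in> {1..n} \<times> {1..n}. ws ! (fst z + snd z) = w} \<subseteq> (\<lambda>(l, i). (i, l - i)) ` (L \<times> {1..n})"
  proof clarsimp
    fix i j assume *: "Suc 0 \<le> i" "i \<le> n" "Suc 0 \<le> j" "j \<le> n" "w = ws ! (i + j)"
    then have "(i + j, i) \<in> L \<times> {1..n}"
      using assms by (simp add: L_def)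
    then show "(i, j) \<in> (\<lambda>(l, i). (i, l - i)) ` (L \<times> {Suc 0..n})"
      by (intro image_eqI[where x = "(i + j, i)"]) auto
  qed
  then have "card {z \<in> {1..n} \<times> {1..n}. ws ! (fst z + snd z) = w} \<le> card (L \<times> {1..n})"
    using L(1) by (intro surj_card_le) auto
  then show ?thesis
    using L(2) by (simp add: card_cartesian_product)
qed

definition blowup :: "nat \<Rightarrow> nat \<Rightarrow> nat \<Rightarrow> (nat \<Rightarrow> nat \<Rightarrow> nat) \<Rightarrow> ((nat + nat) \<times> nat) graph" where
  "blowup d m N p = (({..<m} <+> {..<m}) \<times> {..<N},
     (\<lambda>(i, x, a, b). {(Inl x, a), (Inr (p i x), b)}) ` ({..<d} \<times> {..<m} \<times> {..<N} \<times> {..<N}))"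

lemma finite_graph_blowup:
  assumes "\<And>i. i < d \<Longrightarrow> p i permutes {..<m}"
  shows "finite_graph (blowup d m N p)"
  using permutes_in_image[OF assms] by (auto simp: finite_graph_def blowup_def nsets_def)

lemma card_edges_blowup: "card (edges (blowup d m N p)) \<le> d * m * N\<^sup>2"
proof -
  have "card (edges (blowup d m N p)) \<le> card ({..<d} \<times> {..<m} \<times> {..<N} \<times> {..<N})"
    unfolding blowup_def snd_conv by (intro card_image_le) auto
  then show ?thesis
    by (simp add: card_cartesian_product power2_eq_square mult_ac)
qed

text \<open>Here \<open>41984 = 1024 * 41\<close>: a vertex of the base graph occurs at most 41 times in the walk, each time
  for at most \<open>n\<close> grid vertices, and these may occupy a fraction \<open>1/1024\<close> of its part.\<close>

lemma blowup_arrows_grid: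
  fixes n q m :: nat and \<kappa> :: real
  assumes \<kappa>: "0 < \<kappa>"
    and matchings: "\<And>(col :: (nat + nat) \<times> nat \<Rightarrow> (nat + nat) \<times> nat \<Rightarrow> bool)
        (A :: nat \<Rightarrow> ((nat + nat) \<times> nat) set) B (\<pi> :: nat \<Rightarrow> nat \<Rightarrow> nat).
     (\<forall>x. finite (A x) \<and> finite (B x) \<and> A x \<noteq> {} \<and> B x \<noteq> {}) \<Longrightarrow>
     (\<forall>i<40. bij (\<pi> i)) \<Longrightarrow>
     (\<exists>A' B' c. (\<forall>x. A' x \<subseteq> A x \<and> B' x \<subseteq> B x \<and>
          real (card (A' x)) \<ge> \<kappa> * card (A x) \<and> real (card (B' x)) \<ge> \<kappa> * card (B x)) \<and>
        (\<forall>i<40. \<forall>x. dense (1/2048) (1/4) (\<lambda>u v. col u v = c i x) (A' x) (B' (\<pi> i x))))"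
    and q: "41984 \<le> \<kappa> * q" and n: "0 < n" and m: "m = 131072 * n"
    and p: "\<And>i. i < 40 \<Longrightarrow> p i permutes {..<m}"
    and sparse: "\<And>A B. A \<subseteq> {..<m} \<Longrightarrow> B \<subseteq> {..<m} \<Longrightarrow> 65536 * (card A + card B) \<le> m \<Longrightarrow>
       card {(i, x). i < 40 \<and> x \<in> A \<and> p i x \<in> B} \<le> 5 * (card A + card B)"
  shows "arrows (blowup 40 m (q * n) p) (grid_graph n n)"
  unfolding arrows_def
proof
  fix c :: "((nat + nat) \<times> nat) set \<Rightarrow> bool"
  define N where "N = q * n"
  define G where "G = blowup 40 m N p"
  have "q > 0"
    using q by (cases "q = 0") auto
  then have N: "N > 0"
    using n by (simp add: N_def)
  \<comment> \<open>There is a part for every natural number, since the cleaning works with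
    bijections of the whole type; outside \<open>{..<m}\<close> each \<open>p i\<close> is the
    identity.\<close>
  define A B where "A x = {Inl x :: nat + nat} \<times> {..<N}" and "B x = {Inr x :: nat + nat} \<times> {..<N}" for x :: nat
  have AB: "finite (A x)" "finite (B x)" "A x \<noteq> {}" "B x \<noteq> {}" "card (A x) = N" "card (B x) = N" for x
    using N by (auto simp: A_def B_def card_cartesian_product)
  have "\<exists>A' B' cc. (\<forall>x. A' x \<subseteq> A x \<and> B' x \<subseteq> B x \<and>
          real (card (A' x)) \<ge> \<kappa> * card (A x) \<and> real (card (B' x)) \<ge> \<kappa> * card (B x)) \<and>
        (\<forall>i<40. \<forall>x. dense (1/2048) (1/4) (\<lambda>u v. c {u, v} = cc i x) (A' x) (B' (p i x)))"
    using AB by (intro matchings) (auto intro: permutes_bij[OF p])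
  then obtain A' B' cc where sub: "\<And>x. A' x \<subseteq> A x" "\<And>x. B' x \<subseteq> B x"
    and size: "\<And>x. real (card (A' x)) \<ge> \<kappa> * N" "\<And>x. real (card (B' x)) \<ge> \<kappa> * N"
    and dns: "\<And>i x. i < 40 \<Longrightarrow> dense (1/2048) (1/4) (\<lambda>u v. c {u, v} = cc i x) (A' x) (B' (p i x))"
    unfolding AB(5,6) by blast
  have "m > 0" using n m by simp
  \<comment> \<open>The colour \<open>cc i x\<close> belongs to the index \<open>(i, x)\<close>. An
    edge shared by two matchings may carry both colours, and its pair of parts is then dense in
    each.\<close>
  from ex_large_monochromatic_component[OF p sparse this, of cc] obtain k v
    where v: "v \<in> {..<m} <+> {..<m}"
      and large: "m < 65536 * card {u. (hadj 40 m p (\<lambda>i x. cc i x = k))\<^sup>*\<^sup>* v u}"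
    by blast
  define adj where "adj = hadj 40 m p (\<lambda>i x. cc i x = k)"
  have "card {u. adj\<^sup>*\<^sup>* v u} > 0" using large by (simp add: adj_def)
  then have fin: "finite {u. adj\<^sup>*\<^sup>* v u}" by (simp add: card_gt_0_iff)
  obtain ws where ws: "successively adj ws" "set ws = {u. adj\<^sup>*\<^sup>* v u}" "\<And>u. count_list ws u \<le> 41"
    using traversal_walk[OF _ fin, of 40] hadj_sym hadj_degree[OF p] unfolding adj_def by auto
  \<comment> \<open>As \<open>m\<close> is \<open>2 * 65536 * n\<close>, the component has more than
    \<open>2 * n\<close> vertices, where \<open>2 * n\<close> is the largest value of
    \<open>i + j\<close>.\<close>
  have len: "2 * n < length ws"
    using large card_length[of ws] m unfolding ws(2) adj_def[symmetric] by linarith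
  have wsV: "u \<in> {..<m} <+> {..<m}" if "u \<in> set ws" for u
  proof -
    have "adj\<^sup>*\<^sup>* v u" using that ws(2) by blast
    then show ?thesis
      using v by (induction rule: rtranclp_induct) (use permutes_in_image[OF p] in \<open>auto simp: adj_def hadj_def\<close>)
  qed
  define W where "W = {1..n} \<times> {1..n}"
  define h where "h z = ws ! (fst z + snd z)" for z
  define U where "U w = (case w of Inl x \<Rightarrow> A' x | Inr y \<Rightarrow> B' y)" for w
  define E where "E a b \<longleftrightarrow> {a, b} \<in> edges G \<and> c {a, b} = k" for a b
  have hW: "h z \<in> set ws" if "z \<in> W" for z
    using that len by (auto simp: h_def W_def)
  have U_sub: "U w \<subseteq> {w} \<times> {..<N}" for w
    using sub by (auto simp: U_def A_def B_def split: sum.splits)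
  have U_card: "real (card (U w)) \<ge> \<kappa> * N" for w
    using size by (auto simp: U_def split: sum.splits)
  have "\<exists>\<phi>. inj_on \<phi> W \<and> (\<forall>z\<in>W. \<phi> z \<in> U (h z)) \<and>
    (\<forall>z\<in>W. \<forall>z'\<in>W. grid_adj z z' \<longrightarrow> E (\<phi> z) (\<phi> z'))"
  \<comment> \<open>Grid vertices have at most 4 neighbours, so candidate sets keep a fraction
    \<open>(1/4) ^ 4 = 4/1024\<close>, while \<open>4 * (1/2048) + 1/1024 = 3/1024\<close> is
    excluded.\<close>
  proof (rule greedy_embedding[where h = h and U = U and \<Delta> = 4 and \<rho> = "1/2048" and \<delta> = "1/4" and \<sigma> = "1/1024"])
    show "finite W" by (simp add: W_def)
    show "grid_adj z' z" if "grid_adj z z'" for z z'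
      using that by (auto simp: grid_adj_def)
    show "\<not> grid_adj z z" for z
      by (auto simp: grid_adj_def)
    show "card {z' \<in> W. grid_adj z z'} \<le> 4" for z
      by (rule grid_adj_degree)
    show "finite (U (h z)) \<and> U (h z) \<noteq> {}" for z
    proof -
      have "real (card (U (h z))) > 0"
        using U_card[of "h z"] \<kappa> N by (smt (verit) mult_pos_pos of_nat_0_less_iff)
      then show ?thesis by (simp add: card_gt_0_iff)
    qed
    show "U (h z) \<inter> U (h z') = {}" if "h z \<noteq> h z'" for z z'
      using that U_sub[of "h z"] U_sub[of "h z'"] by fastforce
    show E_sym: "E b a" if "E a b" for a b
      using that by (simp add: E_def insert_commute)
    show "dense (1/2048) (1/4) E (U (h z)) (U (h z'))" if z: "z \<in> W" "z' \<in> W" "grid_adj z z'" for z z'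
    proof -
      have step: "adj (ws ! l) (ws ! Suc l)" if "Suc l < length ws" for l
        using ws(1) that by (simp add: successively_conv_nth)
      have "fst z' + snd z' = Suc (fst z + snd z) \<or> fst z + snd z = Suc (fst z' + snd z')"
        using z(3) by (auto simp: grid_adj_def)
      moreover have "fst z + snd z < length ws" "fst z' + snd z' < length ws"
        using z len by (auto simp: W_def)
      ultimately have "adj (h z) (h z')"
        using step hadj_sym unfolding h_def adj_def by metis
      then obtain i x where ix: "i < 40" "x < m" "cc i x = k"
        and h: "h z = Inl x \<and> h z' = Inr (p i x) \<or> h z = Inr (p i x) \<and> h z' = Inl x"
        by (auto simp: adj_def hadj_def)
      \<comment> \<open>The blow-up is complete between adjacent parts, so there \<open>E\<close> is
        decided by the colour alone.\<close>
      have "E a b \<longleftrightarrow> c {a, b} = cc i x" if "a \<in> A' x" "b \<in> B' (p i x)" for a b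
      proof -
        have "a \<in> A x" "b \<in> B (p i x)"
          using that sub by blast+
        then obtain s t where st: "a = (Inl x, s)" "b = (Inr (p i x), t)" "s < N" "t < N"
          unfolding A_def B_def by blast
        have "{a, b} \<in> edges G"
          unfolding G_def blowup_def snd_conv
          by (rule image_eqI[of _ _ "(i, x, s, t)"]) (use ix st in auto)
        then show ?thesis using ix by (simp add: E_def)
      qed
      then have "dense (1/2048) (1/4) E (A' x) (B' (p i x)) =
          dense (1/2048) (1/4) (\<lambda>a b. c {a, b} = cc i x) (A' x) (B' (p i x))"
        by (rule dense_cong)
      then have d: "dense (1/2048) (1/4) E (A' x) (B' (p i x))"
        using dns[OF ix(1), of x] by simp
      have "(\<lambda>a b. E b a) = E"
        by (intro ext iffI) (erule E_sym)+
      then have "dense (1/2048) (1/4) E (B' (p i x)) (A' x)"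
        using dense_swap[OF d] by simp
      with d h show ?thesis by (auto simp: U_def)
    qed
    show "real (card {z' \<in> W. h z' = h z}) \<le> 1/1024 * card (U (h z))" for z
    proof -
      have "card {z' \<in> W. h z' = h z} \<le> count_list ws (h z) * n"
        unfolding W_def h_def by (rule card_grid_fibre[OF len])
      also have "\<dots> \<le> 41 * n" using ws(3) by simp
      finally have "real (card {z' \<in> W. h z' = h z}) \<le> 41 * real n" by simp
      moreover have "41984 * real n \<le> \<kappa> * q * n"
        using q by (rule mult_right_mono) simp
      moreover have "\<kappa> * q * n \<le> card (U (h z))"
        using U_card[of "h z"] by (simp add: N_def mult.assoc)
      ultimately show ?thesis by linarith
    qed
  qed (simp_all add: power_divide)
  then obtain \<phi> where \<phi>: "inj_on \<phi> W" "\<And>z. z \<in> W \<Longrightarrow> \<phi> z \<in> U (h z)"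
    "\<And>z z'. z \<in> W \<Longrightarrow> z' \<in> W \<Longrightarrow> grid_adj z z' \<Longrightarrow> E (\<phi> z) (\<phi> z')"
    by blast
  have e: "\<phi> ` e \<in> edges G \<and> c (\<phi> ` e) = k" if "e \<in> edges (grid_graph n n)" for e
    using that
  proof (rule edges_grid_graphE)
    fix u v assume "e = {u, v}" "u \<in> {1..n} \<times> {1..n}" "v \<in> {1..n} \<times> {1..n}" "grid_adj u v"
    then show ?thesis using \<phi>(3)[of u v] by (simp add: W_def E_def)
  qed
  have "\<phi> ` W \<subseteq> verts G"
    using \<phi>(2) U_sub hW wsV by (fastforce simp: G_def blowup_def)
  then have "is_copy \<phi> (grid_graph n n) G"
    using \<phi>(1) e by (auto simp: is_copy_def grid_graph_def W_def)
  then show "\<exists>f k. is_copy f (grid_graph n n) (blowup 40 m (q * n) p) \<and> (\<forall>e\<in>edges (grid_graph n n). c (f ` e) = k)"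
    using e unfolding G_def N_def by blast
qed

section \<open>The cubic bound and its asymptotic form\<close>

theorem size_ramsey_grid_cubic:
  "\<exists>K::nat. K > 0 \<and> (\<forall>n>0. size_ramsey (grid_graph n n) \<le> K * n ^ 3)"
proof -
  have "0 < (1/2048 :: real)" "(1/2048 :: real) \<le> 1" by auto
  from dense_along_matchings[OF this, where ?'a = "(nat + nat) \<times> nat" and ?'b = "(nat + nat) \<times> nat" and d = 40]
  obtain \<kappa> :: real where \<kappa>: "0 < \<kappa>" and
    matchings: "\<forall>(col :: (nat + nat) \<times> nat \<Rightarrow> (nat + nat) \<times> nat \<Rightarrow> bool)
        (A :: nat \<Rightarrow> ((nat + nat) \<times> nat) set) B (\<pi> :: nat \<Rightarrow> nat \<Rightarrow> nat).
     (\<forall>x. finite (A x) \<and> finite (B x) \<and> A x \<noteq> {} \<and> B x \<noteq> {}) \<longrightarrow>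
     (\<forall>i<40. bij (\<pi> i)) \<longrightarrow>
     (\<exists>A' B' c. (\<forall>x. A' x \<subseteq> A x \<and> B' x \<subseteq> B x \<and>
          real (card (A' x)) \<ge> \<kappa> * card (A x) \<and> real (card (B' x)) \<ge> \<kappa> * card (B x)) \<and>
        (\<forall>i<40. \<forall>x. dense (1/2048) (1/4) (\<lambda>u v. col u v = c i x) (A' x) (B' (\<pi> i x))))"
    by (elim exE conjE) (rule that)
  \<comment> \<open>\<kappa> was fixed before \<open>n\<close>, so \<open>q\<close> is a constant.
    The blow-up has \<open>131072 * n\<close> parts on each side, of size \<open>q * n\<close> each,
    and thus at most a constant times \<open>n ^ 3\<close> edges.\<close>
  define q where "q = nat \<lceil>41984 / \<kappa>\<rceil>"
  have "41984 / \<kappa> \<le> q"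
    unfolding q_def by linarith
  then have q: "41984 \<le> \<kappa> * q"
    using \<kappa> by (simp add: field_simps)
  then have "q > 0" by (cases "q = 0") auto
  have "size_ramsey (grid_graph n n) \<le> (40 * 131072 * q\<^sup>2) * n ^ 3" if "n > 0" for n
  proof -
    define m where "m = 131072 * n"
    obtain p :: "nat \<Rightarrow> nat \<Rightarrow> nat" where perms: "\<forall>i<40. p i permutes {..<m}"
      and sparse_p: "\<forall>A\<subseteq>{..<m}. \<forall>B\<subseteq>{..<m}. 65536 * (card A + card B) \<le> m \<longrightarrow>
       card {(i, x). i < 40 \<and> x \<in> A \<and> p i x \<in> B} \<le> 5 * (card A + card B)"
      using ex_sparse_permutations[of m] by (elim exE conjE) (rule that)
    have p: "p i permutes {..<m}" if "i < 40" for i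
      using perms that by simp
    have sparse: "card {(i, x). i < 40 \<and> x \<in> A \<and> p i x \<in> B} \<le> 5 * (card A + card B)"
      if "A \<subseteq> {..<m}" "B \<subseteq> {..<m}" "65536 * (card A + card B) \<le> m" for A B
      using sparse_p[THEN spec, THEN mp, OF that(1), THEN spec, THEN mp, OF that(2), THEN mp, OF that(3)] .
    have "arrows (blowup 40 m (q * n) p) (grid_graph n n)"
      by (rule blowup_arrows_grid[OF \<kappa> _ q that m_def])
         ((rule matchings[THEN spec, THEN spec, THEN spec, THEN spec, THEN mp, THEN mp] p sparse; assumption)+)
    then have "size_ramsey (grid_graph n n) \<le> card (edges (blowup 40 m (q * n) p))"
      by (intro size_ramsey_le_countable finite_graph_blowup p)
    also have "\<dots> \<le> 40 * m * (q * n)\<^sup>2"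
      by (rule card_edges_blowup)
    also have "\<dots> = (40 * 131072 * q\<^sup>2) * n ^ 3"
      by (simp add: m_def power2_eq_square power3_eq_cube)
    finally show ?thesis .
  qed
  moreover have "40 * 131072 * q\<^sup>2 > 0" using \<open>q > 0\<close> by simp
  ultimately show ?thesis by blast
qed

theorem corollary1p2:
  shows "\<forall>\<epsilon>::real. \<epsilon> > 0 \<longrightarrow>
    (\<exists>n\<^sub>0::nat. \<forall>n\<ge>n\<^sub>0. real (size_ramsey (grid_graph n n)) \<le> real n powr (3 + \<epsilon>))"
proof (intro allI impI)
  fix \<epsilon> :: real
  assume "\<epsilon> > 0"
  obtain K :: nat where K: "K > 0" "\<And>n. n > 0 \<Longrightarrow> size_ramsey (grid_graph n n) \<le> K * n ^ 3"
    using size_ramsey_grid_cubic by blast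
  \<comment> \<open>From here on \<open>n powr \<epsilon>\<close> is at least \<open>K\<close>; the
    \<open>Suc\<close> keeps \<open>n\<close> positive.\<close>
  define n\<^sub>0 where "n\<^sub>0 = Suc (nat \<lceil>real K powr (1 / \<epsilon>)\<rceil>)"
  have "real (size_ramsey (grid_graph n n)) \<le> real n powr (3 + \<epsilon>)" if "n \<ge> n\<^sub>0" for n
  proof -
    have n: "n > 0" "real K powr (1 / \<epsilon>) \<le> n"
      using that unfolding n\<^sub>0_def by linarith+
    have "real K = (real K powr (1 / \<epsilon>)) powr \<epsilon>"
      using \<open>\<epsilon> > 0\<close> by (simp add: powr_powr)
    also have "\<dots> \<le> real n powr \<epsilon>"
      using n \<open>\<epsilon> > 0\<close> by (intro powr_mono2) auto
    finally have "real K * real n ^ 3 \<le> real n powr \<epsilon> * real n ^ 3"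
      by (intro mult_right_mono) auto
    moreover have "real (size_ramsey (grid_graph n n)) \<le> real K * real n ^ 3"
      using K(2)[OF n(1)] by (metis of_nat_le_iff of_nat_mult of_nat_power)
    moreover have "real n powr \<epsilon> * real n ^ 3 = real n powr (3 + \<epsilon>)"
      using n by (simp add: powr_add powr_realpow mult.commute)
    ultimately show ?thesis by linarith
  qed
  then show "\<exists>n\<^sub>0::nat. \<forall>n\<ge>n\<^sub>0. real (size_ramsey (grid_graph n n)) \<le> real n powr (3 + \<epsilon>)"
    by blast
qed

end
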